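(* Let $G$ be a torsion group with no elements of order $2$. Then $G\otimes G\cong\nabla(G)\times(G\wedge G)$. In particular, $\pi_2^S(K(G,1))\cong H_2(G)$ and $\pi_3(SK(G,1))\cong H_2(G)\times\nabla(G)$.
   Context: Write ${}^{g}g'=gg'g^{-1}$. The nonabelian tensor square $G\otimes G$ is the group generated by symbols $g\otimes h$ ($g,h\in G$) with relations $gg'\otimes h=({}^gg'\otimes{}^gh)(g\otimes h)$ and $g\otimes hh'=(g\otimes h)({}^hg\otimes{}^hh')$. Let $\kappa:G\otimes G\to G'$, $g\otimes h\mapsto[g,h]=ghg^{-1}h^{-1}$, and $J(G)=\ker\kappa$, a central subgroup. $\nabla(G)\le J(G)$ is generated by all $x\otimes x$, and $\Delta(G)\le\nabla(G)$ by all $(x\otimes y)(y\otimes x)$, $x,y\in G$. Put $G\wedge G=(G\otimes G)/\nabla(G)$. $H_2(G)$ is the second integral homology group (Schur multiplier), identified with $J(G)/\nabla(G)$ (Miller). $K(G,1)$ is the Eilenberg–MacLane space, $S$ denotes suspension; $\pi_3(SK(G,1))$ is identified with $J(G)$, and the second stable homotopy group $\pi_2^S(K(G,1))=\pi_4(S^2K(G,1))$ with $J(G)/\Delta(G)$ (Brown–Loday). *)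

theory Defs
  imports "HOL-Analysis.Analysis" "HOL-Algebra.Free_Abelian_Groups" "HOL-Algebra.Multiplicative_Group"
begin

section \<open>Groups given by generators and relations\<close>

text \<open>A word is a list of letters; the letter \<open>(x, True)\<close> stands for the generator \<open>x\<close> and
  \<open>(x, False)\<close> for its inverse. A relation \<open>u = v\<close> is a pair of words.\<close>

type_synonym 'x word = "('x \<times> bool) list"

abbreviation words :: "'x set \<Rightarrow> 'x word set" where
  "words S \<equiv> lists (S \<times> UNIV)"

inductive_set pres_rel :: "'x set \<Rightarrow> ('x word \<times> 'x word) set \<Rightarrow> ('x word \<times> 'x word) set"
  for S R where
  refl: "w \<in> words S \<Longrightarrow> (w, w) \<in> pres_rel S R"
| sym: "(u, v) \<in> pres_rel S R \<Longrightarrow> (v, u) \<in> pres_rel S R"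
| trans: "(u, v) \<in> pres_rel S R \<Longrightarrow> (v, w) \<in> pres_rel S R \<Longrightarrow> (u, w) \<in> pres_rel S R"
| append: "(u, u') \<in> pres_rel S R \<Longrightarrow> (v, v') \<in> pres_rel S R \<Longrightarrow> (u @ v, u' @ v') \<in> pres_rel S R"
| cancel: "x \<in> S \<Longrightarrow> ([(x, b), (x, \<not> b)], []) \<in> pres_rel S R"
| relation: "(u, v) \<in> R \<Longrightarrow> u \<in> words S \<Longrightarrow> v \<in> words S \<Longrightarrow> (u, v) \<in> pres_rel S R"

definition presented_group :: "'x set \<Rightarrow> ('x word \<times> 'x word) set \<Rightarrow> 'x word set monoid" where
  "presented_group S R =
     \<lparr>carrier = words S // pres_rel S R,
      mult = (\<lambda>A B. \<Union>a\<in>A. \<Union>b\<in>B. pres_rel S R `` {a @ b}),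
      one = pres_rel S R `` {[]}\<rparr>"

section \<open>The nonabelian tensor square\<close>

definition conj_act :: "('a, 'm) monoid_scheme \<Rightarrow> 'a \<Rightarrow> 'a \<Rightarrow> 'a" where
  "conj_act G g h = g \<otimes>\<^bsub>G\<^esub> h \<otimes>\<^bsub>G\<^esub> inv\<^bsub>G\<^esub> g"

definition tensor_relations ::
    "('a, 'm) monoid_scheme \<Rightarrow> (('a \<times> 'a) word \<times> ('a \<times> 'a) word) set" where
  "tensor_relations G =
     {([((g \<otimes>\<^bsub>G\<^esub> g', h), True)], [((conj_act G g g', conj_act G g h), True), ((g, h), True)])
       | g g' h. g \<in> carrier G \<and> g' \<in> carrier G \<and> h \<in> carrier G} \<union>
     {([((g, h \<otimes>\<^bsub>G\<^esub> h'), True)], [((g, h), True), ((conj_act G h g, conj_act G h h'), True)])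
       | g h h'. g \<in> carrier G \<and> h \<in> carrier G \<and> h' \<in> carrier G}"

definition tensor_square :: "('a, 'm) monoid_scheme \<Rightarrow> ('a \<times> 'a) word set monoid" where
  "tensor_square G = presented_group (carrier G \<times> carrier G) (tensor_relations G)"

definition tensor_elt :: "('a, 'm) monoid_scheme \<Rightarrow> 'a \<Rightarrow> 'a \<Rightarrow> ('a \<times> 'a) word set" where
  "tensor_elt G g h =
     pres_rel (carrier G \<times> carrier G) (tensor_relations G) `` {[((g, h), True)]}"

definition commutator_elt :: "('a, 'm) monoid_scheme \<Rightarrow> 'a \<Rightarrow> 'a \<Rightarrow> 'a" where
  "commutator_elt G g h = g \<otimes>\<^bsub>G\<^esub> h \<otimes>\<^bsub>G\<^esub> inv\<^bsub>G\<^esub> g \<otimes>\<^bsub>G\<^esub> inv\<^bsub>G\<^esub> h"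

fun commutator_word :: "('a, 'm) monoid_scheme \<Rightarrow> ('a \<times> 'a) word \<Rightarrow> 'a" where
  "commutator_word G [] = \<one>\<^bsub>G\<^esub>"
| "commutator_word G (((g, h), b) # w) =
     (if b then commutator_elt G g h else inv\<^bsub>G\<^esub> (commutator_elt G g h))
       \<otimes>\<^bsub>G\<^esub> commutator_word G w"

text \<open>The value of \<^term>\<open>commutator_word G\<close> is constant on each element of the tensor square
  (the commutators satisfy the defining relations), so \<open>the_elem\<close> picks that value.\<close>

definition kappa :: "('a, 'm) monoid_scheme \<Rightarrow> ('a \<times> 'a) word set \<Rightarrow> 'a" where
  "kappa G c = the_elem (commutator_word G ` c)"

definition J_group :: "('a, 'm) monoid_scheme \<Rightarrow> ('a \<times> 'a) word set monoid" where
  "J_group G = (tensor_square G)\<lparr>carrier := kernel (tensor_square G) G (kappa G)\<rparr>"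

definition nabla :: "('a, 'm) monoid_scheme \<Rightarrow> ('a \<times> 'a) word set set" where
  "nabla G = generate (tensor_square G) {tensor_elt G x x | x. x \<in> carrier G}"

definition nabla_group :: "('a, 'm) monoid_scheme \<Rightarrow> ('a \<times> 'a) word set monoid" where
  "nabla_group G = (tensor_square G)\<lparr>carrier := nabla G\<rparr>"

definition Delta :: "('a, 'm) monoid_scheme \<Rightarrow> ('a \<times> 'a) word set set" where
  "Delta G = generate (tensor_square G)
     {tensor_elt G x y \<otimes>\<^bsub>tensor_square G\<^esub> tensor_elt G y x | x y. x \<in> carrier G \<and> y \<in> carrier G}"

definition exterior_square :: "('a, 'm) monoid_scheme \<Rightarrow> ('a \<times> 'a) word set set monoid" where
  "exterior_square G = tensor_square G Mod nabla G"

section \<open>The second integral homology group\<close>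

text \<open>Homology of the (unnormalised) bar complex with trivial integral coefficients, in degree two:
  \<open>[g|h] \<mapsto> [h] - [gh] + [g]\<close> and
  \<open>[g|h|k] \<mapsto> [h|k] - [gh|k] + [g|hk] - [g|h]\<close>.\<close>

definition bar_d2 :: "('a, 'm) monoid_scheme \<Rightarrow> ('a \<times> 'a \<Rightarrow>\<^sub>0 int) \<Rightarrow> ('a \<Rightarrow>\<^sub>0 int)" where
  "bar_d2 G = frag_extend (\<lambda>(g, h). frag_of h - frag_of (g \<otimes>\<^bsub>G\<^esub> h) + frag_of g)"

definition bar_d3 ::
    "('a, 'm) monoid_scheme \<Rightarrow> ('a \<times> 'a \<times> 'a \<Rightarrow>\<^sub>0 int) \<Rightarrow> ('a \<times> 'a \<Rightarrow>\<^sub>0 int)" where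
  "bar_d3 G = frag_extend (\<lambda>(g, h, k). frag_of (h, k) - frag_of (g \<otimes>\<^bsub>G\<^esub> h, k)
                                      + frag_of (g, h \<otimes>\<^bsub>G\<^esub> k) - frag_of (g, h))"

definition H2 :: "('a, 'm) monoid_scheme \<Rightarrow> ('a \<times> 'a \<Rightarrow>\<^sub>0 int) set monoid" where
  "H2 G =
     (let C1 = free_Abelian_group (carrier G);
          C2 = free_Abelian_group (carrier G \<times> carrier G);
          C3 = free_Abelian_group (carrier G \<times> carrier G \<times> carrier G)
      in C2\<lparr>carrier := kernel C2 C1 (bar_d2 G)\<rparr> Mod (bar_d3 G ` carrier C3))"

section \<open>Homotopy groups, suspensions and Eilenberg--MacLane spaces\<close>

definition unit_cube :: "nat \<Rightarrow> (nat \<Rightarrow> real) topology" where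
  "unit_cube n = product_topology (\<lambda>_. top_of_set {0..1}) {..<n}"

definition cube_boundary :: "nat \<Rightarrow> (nat \<Rightarrow> real) set" where
  "cube_boundary n = {t \<in> topspace (unit_cube n). \<exists>i<n. t i = 0 \<or> t i = 1}"

definition spheroids :: "nat \<Rightarrow> 'b topology \<Rightarrow> 'b \<Rightarrow> ((nat \<Rightarrow> real) \<Rightarrow> 'b) set" where
  "spheroids n X x0 = {f. continuous_map (unit_cube n) X f \<and> (\<forall>t\<in>cube_boundary n. f t = x0)}"

definition spheroid_rel ::
    "nat \<Rightarrow> 'b topology \<Rightarrow> 'b \<Rightarrow> (((nat \<Rightarrow> real) \<Rightarrow> 'b) \<times> ((nat \<Rightarrow> real) \<Rightarrow> 'b)) set" where
  "spheroid_rel n X x0 =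
     {(f, g). homotopic_with (\<lambda>h. \<forall>t\<in>cube_boundary n. h t = x0) (unit_cube n) X f g}"

definition spheroid_join ::
    "((nat \<Rightarrow> real) \<Rightarrow> 'b) \<Rightarrow> ((nat \<Rightarrow> real) \<Rightarrow> 'b) \<Rightarrow> (nat \<Rightarrow> real) \<Rightarrow> 'b" where
  "spheroid_join f g =
     (\<lambda>t. if t 0 \<le> 1/2 then f (t(0 := 2 * t 0)) else g (t(0 := 2 * t 0 - 1)))"

text \<open>Spheroids are joined along the first coordinate, so only \<open>n \<ge> 1\<close> is meaningful.\<close>

definition homotopy_group ::
    "nat \<Rightarrow> 'b topology \<Rightarrow> 'b \<Rightarrow> ((nat \<Rightarrow> real) \<Rightarrow> 'b) set monoid" where
  "homotopy_group n X x0 =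
     \<lparr>carrier = spheroids n X x0 // spheroid_rel n X x0,
      mult = (\<lambda>A B. \<Union>f\<in>A. \<Union>g\<in>B. spheroid_rel n X x0 `` {spheroid_join f g}),
      one = spheroid_rel n X x0 `` {\<lambda>_. x0}\<rparr>"

text \<open>The unreduced suspension: the quotient of \<open>X \<times> [0,1]\<close> that collapses \<open>X \<times> {0}\<close> and
  \<open>X \<times> {1}\<close> to one point each; points are the equivalence classes. The pole \<open>X \<times> {0}\<close> serves as
  base point. No well-pointedness is needed for this version to preserve weak equivalences.\<close>

definition susp_proj :: "'b topology \<Rightarrow> 'b \<times> real \<Rightarrow> ('b \<times> real) set" where
  "susp_proj X = (\<lambda>(x, t). if t = 0 \<or> t = 1 then topspace X \<times> {t} else {(x, t)})"

definition suspension :: "'b topology \<Rightarrow> ('b \<times> real) set topology" where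
  "suspension X =
     (let C = prod_topology X (top_of_set {0..1})
      in topology (\<lambda>U. U \<subseteq> susp_proj X ` topspace C \<and>
                       openin C {z \<in> topspace C. susp_proj X z \<in> U}))"

definition susp_base :: "'b topology \<Rightarrow> ('b \<times> real) set" where
  "susp_base X = topspace X \<times> {0}"

definition eilenberg_maclane_1 :: "('a, 'm) monoid_scheme \<Rightarrow> 'b topology \<Rightarrow> 'b \<Rightarrow> bool" where
  "eilenberg_maclane_1 G X x0 \<longleftrightarrow>
     path_connected_space X \<and> x0 \<in> topspace X \<and> homotopy_group 1 X x0 \<cong> G \<and>
     (\<forall>n\<ge>2. carrier (homotopy_group n X x0) = {\<one>\<^bsub>homotopy_group n X x0\<^esub>})"

abbreviation pi_3_S :: "'b topology \<Rightarrow> ((nat \<Rightarrow> real) \<Rightarrow> ('b \<times> real) set) set monoid" where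
  "pi_3_S X \<equiv> homotopy_group 3 (suspension X) (susp_base X)"

text \<open>For a connected space \<open>X\<close>, the second stable homotopy group is \<open>\<pi>\<^sub>4(S\<^sup>2X)\<close>.\<close>

abbreviation pi_2_stable ::
    "'b topology \<Rightarrow> ((nat \<Rightarrow> real) \<Rightarrow> (('b \<times> real) set \<times> real) set) set monoid" where
  "pi_2_stable X \<equiv> homotopy_group 4 (suspension (suspension X)) (susp_base (suspension X))"

end

theory Submission
  imports Defs "HOL-Algebra.Bij"
begin

text \<open>
  Let \<open>T\<close> be the tensor square, \<open>J = ker \<kappa>\<close> and \<open>\<nabla> \<subseteq> J\<close>. Since \<open>T\<close> acts on itself by conjugation
  through \<open>\<kappa>\<close>, the subgroup \<open>J\<close> is central. The automorphism \<open>\<sigma>: g \<otimes> h \<mapsto> (h \<otimes> g)\<^sup>-\<^sup>1\<close>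
  commutes with \<open>\<kappa>\<close>, so \<open>t \<mapsto> t \<sigma>(t)\<^sup>-\<^sup>1\<close> is a homomorphism \<open>T \<rightarrow> \<nabla>\<close>, and it restricts to squaring
  on \<open>\<nabla>\<close>. As \<open>(x \<otimes> x)\<^sup>n = x\<^sup>n \<otimes> x\<close>, the group \<open>\<nabla>\<close> is torsion without 2-torsion; squaring is
  bijective on it, \<open>\<Delta> = \<nabla>\<close>, and both \<open>T\<close> and \<open>J\<close> split.

  For \<open>J/\<nabla> \<cong> H\<^sub>2(G)\<close> let \<open>B\<close> be the bar 2-chains modulo boundaries and \<open>E\<close> the extension of \<open>G\<close> by
  \<open>B\<close> with the tautological cocycle (this is \<open>F/[F,R]\<close> for the free group \<open>F\<close> on the set \<open>G\<close>).
  Commutators of lifts give \<open>\<omega>: T \<rightarrow> E\<close>, with range the kernel of \<open>E \<rightarrow> \<int>[G]\<close>,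
  \<open>(b, g) \<mapsto> \<partial>b + [g]\<close>; so \<open>\<omega>\<close> maps \<open>J\<close> onto a copy of \<open>H\<^sub>2\<close>. That its kernel is only \<open>\<nabla>\<close> is
  seen by letting \<open>E\<close> act on \<open>(T/\<nabla>) \<times> \<int>[G]\<close>, thought of as normal forms \<open>t \<cdot> \<Prod> x\<^sup>a\<^sup>(\<^sup>x\<^sup>)\<close> with
  the product taken in a fixed linear order of \<open>G\<close>: there \<open>\<omega>(t)\<close> acts as left translation by \<open>t\<close>.
\<close>

section \<open>Presented groups\<close>

(* These rules are applied eagerly and would unfold membership in words. *)
declare in_listsD [rule del] in_listsI [rule del]

section \<open>Words, their evaluation and their inverses\<close>

fun word_eval :: "('h, 'm) monoid_scheme \<Rightarrow> ('x \<Rightarrow> 'h) \<Rightarrow> 'x word \<Rightarrow> 'h" where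
  "word_eval H F [] = \<one>\<^bsub>H\<^esub>"
| "word_eval H F ((x, b) # w) = (if b then F x else inv\<^bsub>H\<^esub> (F x)) \<otimes>\<^bsub>H\<^esub> word_eval H F w"

text \<open>As with \<open>kappa\<close>, the value is read off a whole class by
  \<open>the_elem\<close>. It is meaningful once evaluation is constant on classes, which
  \<open>presentation_map\<close> guarantees.\<close>

definition pres_lift :: "('h, 'm) monoid_scheme \<Rightarrow> ('x \<Rightarrow> 'h) \<Rightarrow> 'x word set \<Rightarrow> 'h" where
  "pres_lift H F c = the_elem (word_eval H F ` c)"

definition word_inv :: "'x word \<Rightarrow> 'x word" where
  "word_inv w = rev (map (\<lambda>(x, b). (x, \<not> b)) w)"

lemma pres_rel_words: "(u, v) \<in> pres_rel S R \<Longrightarrow> u \<in> words S \<and> v \<in> words S"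
  by (induction rule: pres_rel.induct) auto

lemma equiv_pres_rel: "equiv (words S) (pres_rel S R)"
proof (rule equivI)
  show "pres_rel S R \<subseteq> words S \<times> words S"
    by (auto dest!: pres_rel_words)
  show "refl_on (words S) (pres_rel S R)"
    by (auto simp: refl_on_def intro: pres_rel.refl)
  show "sym (pres_rel S R)"
    by (meson pres_rel.sym symI)
  show "trans (pres_rel S R)"
    by (meson pres_rel.trans transI)
qed

lemma pres_class_mult:
  assumes "u \<in> words S" "v \<in> words S"
  shows "pres_rel S R `` {u} \<otimes>\<^bsub>presented_group S R\<^esub> pres_rel S R `` {v} = pres_rel S R `` {u @ v}"
proof -
  let ?C = "\<lambda>w. pres_rel S R `` {w}"
  have eq: "?C (a @ b) = ?C (u @ v)" if "a \<in> ?C u" "b \<in> ?C v" for a b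
    using that by (intro equiv_class_eq[OF equiv_pres_rel pres_rel.sym[OF pres_rel.append]]) simp_all
  \<comment> \<open>By \<open>eq\<close> the double union runs over a constant family; it collapses
    to one class because both index classes contain their representatives.\<close>
  have "(\<Union>a\<in>?C u. \<Union>b\<in>?C v. ?C (a @ b)) = (\<Union>a\<in>?C u. \<Union>b\<in>?C v. ?C (u @ v))"
    by (rule SUP_cong[OF HOL.refl], rule SUP_cong[OF HOL.refl], rule eq)
  moreover have "?C u \<noteq> {}" "?C v \<noteq> {}"
    using assms pres_rel.refl by blast+
  ultimately have "(\<Union>a\<in>?C u. \<Union>b\<in>?C v. ?C (a @ b)) = ?C (u @ v)"
    by (simp only: UN_constant if_False)
  then show ?thesis by (simp add: presented_group_def)
qed

lemma pres_class_in_carrier: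
  "w \<in> words S \<Longrightarrow> pres_rel S R `` {w} \<in> carrier (presented_group S R)"
  by (simp add: presented_group_def quotientI)

lemma pres_carrierE:
  assumes "c \<in> carrier (presented_group S R)"
  obtains w where "w \<in> words S" "c = pres_rel S R `` {w}"
  using assms by (simp add: presented_group_def) (metis quotientE)

lemma pres_one: "\<one>\<^bsub>presented_group S R\<^esub> = pres_rel S R `` {[]}"
  by (simp add: presented_group_def)

lemma word_inv_words: "w \<in> words S \<Longrightarrow> word_inv w \<in> words S"
  by (auto simp: word_inv_def in_lists_conv_set split: prod.splits)

text \<open>The first letter meets its own inverse in the middle; cancelling the two leaves the same
  situation for the tail.\<close>

lemma word_inv_cancel:
  assumes "w \<in> words S"
  shows "(word_inv w @ w, []) \<in> pres_rel S R"
  using assms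
proof (induction w rule: lists.induct)
  case Nil
  then show ?case by (simp add: word_inv_def pres_rel.refl)
next
  case (Cons a w)
  obtain x b where a: "a = (x, b)" by (cases a)
  have xS: "x \<in> S" and w: "w \<in> words S" using Cons.hyps a by simp_all
  have "([(x, \<not> b), (x, b)], []) \<in> pres_rel S R"
    using pres_rel.cancel[OF xS, of "\<not> b"] by simp
  then have "(word_inv w @ [(x, \<not> b), (x, b)] @ w, word_inv w @ [] @ w) \<in> pres_rel S R"
    by (intro pres_rel.append pres_rel.refl word_inv_words w)
  with Cons.IH show ?case
    by (auto simp: word_inv_def a intro: pres_rel.trans)
qed

lemma presented_group_is_group: "group (presented_group S R)"
proof (rule groupI)
  fix x y z
  assume "x \<in> carrier (presented_group S R)" "y \<in> carrier (presented_group S R)"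
    "z \<in> carrier (presented_group S R)"
  then show "x \<otimes>\<^bsub>presented_group S R\<^esub> y \<otimes>\<^bsub>presented_group S R\<^esub> z
      = x \<otimes>\<^bsub>presented_group S R\<^esub> (y \<otimes>\<^bsub>presented_group S R\<^esub> z)"
    by (elim pres_carrierE) (simp add: pres_class_mult)
next
  fix x
  assume "x \<in> carrier (presented_group S R)"
  then obtain w where w: "w \<in> words S" "x = pres_rel S R `` {w}"
    by (rule pres_carrierE)
  have "pres_rel S R `` {word_inv w} \<otimes>\<^bsub>presented_group S R\<^esub> x = \<one>\<^bsub>presented_group S R\<^esub>"
    using w(1) equiv_class_eq[OF equiv_pres_rel word_inv_cancel[OF w(1)]]
    by (simp only: w(2) pres_class_mult word_inv_words pres_one)
  then show "\<exists>y\<in>carrier (presented_group S R).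
      y \<otimes>\<^bsub>presented_group S R\<^esub> x = \<one>\<^bsub>presented_group S R\<^esub>"
    using w word_inv_words pres_class_in_carrier by blast
next
  fix x y
  assume "x \<in> carrier (presented_group S R)" "y \<in> carrier (presented_group S R)"
  then show "x \<otimes>\<^bsub>presented_group S R\<^esub> y \<in> carrier (presented_group S R)"
    by (elim pres_carrierE) (simp add: pres_class_mult pres_class_in_carrier)
next
  show "\<one>\<^bsub>presented_group S R\<^esub> \<in> carrier (presented_group S R)"
    by (simp add: pres_one pres_class_in_carrier)
next
  fix x
  assume "x \<in> carrier (presented_group S R)"
  then show "\<one>\<^bsub>presented_group S R\<^esub> \<otimes>\<^bsub>presented_group S R\<^esub> x = x"
    by (elim pres_carrierE) (simp add: pres_one pres_class_mult)
qed

section \<open>Evaluation of words and von Dyck's theorem\<close>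

lemma (in group) word_eval_closed:
  assumes "F ` S \<subseteq> carrier G" "w \<in> words S"
  shows "word_eval G F w \<in> carrier G"
  using assms(2)
proof (induction w rule: lists.induct)
  case (Cons a w)
  obtain x b where a: "a = (x, b)" by (cases a)
  have "F x \<in> carrier G" using Cons.hyps(1) a assms(1) by (simp add: image_subset_iff)
  then show ?case using Cons.IH by (simp add: a)
qed simp

lemma (in group) word_eval_append:
  assumes "F ` S \<subseteq> carrier G" "u \<in> words S" "v \<in> words S"
  shows "word_eval G F (u @ v) = word_eval G F u \<otimes> word_eval G F v"
  using assms(2)
proof (induction u rule: lists.induct)
  case Nil
  then show ?case using word_eval_closed[OF assms(1,3)] by simp
next
  case (Cons a u)
  obtain x b where a: "a = (x, b)" by (cases a)
  have "F x \<in> carrier G" "u \<in> words S" using Cons.hyps a assms(1) by (simp_all add: image_subset_iff)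
  then show ?case
    using Cons.IH word_eval_closed[OF assms(1)] assms(3)
    by (auto simp: a m_assoc)
qed

text \<open>The hypotheses of von Dyck's theorem. Relations are tested between words over
  \<open>S\<close>, since these are the ones that enter \<open>pres_rel\<close>.\<close>

locale presentation_map = group H for H (structure) +
  fixes S :: "'x set" and R and F
  assumes F_closed: "F ` S \<subseteq> carrier H"
    and F_relations: "\<And>u v. (u, v) \<in> R \<Longrightarrow> u \<in> words S \<Longrightarrow> v \<in> words S
      \<Longrightarrow> word_eval H F u = word_eval H F v"
begin

lemma word_eval_pres_rel:
  "(u, v) \<in> pres_rel S R \<Longrightarrow> word_eval H F u = word_eval H F v"
proof (induction rule: pres_rel.induct)
  case (append u u' v v')
  then show ?case
    using word_eval_append[OF F_closed] pres_rel_words by metis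
next
  case (cancel x b)
  then show ?case using F_closed by (cases b) (auto simp: image_subset_iff)
next
  case (relation u v)
  then show ?case by (rule F_relations)
qed simp_all

lemma pres_lift_class:
  assumes "w \<in> words S"
  shows "pres_lift H F (pres_rel S R `` {w}) = word_eval H F w"
proof -
  have "word_eval H F ` (pres_rel S R `` {w}) = {word_eval H F w}"
    using pres_rel.refl[OF assms, of R] by (auto dest: word_eval_pres_rel[symmetric])
  then show ?thesis by (simp add: pres_lift_def)
qed

lemma pres_lift_hom: "pres_lift H F \<in> hom (presented_group S R) H"
  by (rule homI; elim pres_carrierE; simp add: pres_class_mult pres_lift_class
      word_eval_append[OF F_closed] word_eval_closed[OF F_closed])

lemma pres_lift_generator:
  "x \<in> S \<Longrightarrow> pres_lift H F (pres_rel S R `` {[(x, True)]}) = F x"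
  using F_closed by (auto simp: pres_lift_class)

end

text \<open>The inverse of the class of a generator is the class of the inverse letter, so products
  of classes reproduce words. This yields generation by the letters.\<close>

lemma word_eval_presented_group:
  assumes "w \<in> words S"
  shows "word_eval (presented_group S R) (\<lambda>x. pres_rel S R `` {[(x, True)]}) w = pres_rel S R `` {w}"
  using assms
proof (induction w rule: lists.induct)
  case Nil
  then show ?case by (simp add: pres_one)
next
  case (Cons a w)
  interpret P: group "presented_group S R" by (rule presented_group_is_group)
  obtain x b where a: "a = (x, b)" by (cases a)
  have xS: "x \<in> S" and w: "w \<in> words S" using Cons.hyps a by simp_all
  have "([(x, False), (x, True)], []) \<in> pres_rel S R"
    using pres_rel.cancel[OF xS, of False] by simp
  then have "inv\<^bsub>presented_group S R\<^esub> (pres_rel S R `` {[(x, True)]}) = pres_rel S R `` {[(x, False)]}"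
    using xS by (intro P.inv_equality)
      (simp_all add: pres_class_mult pres_one equiv_class_eq[OF equiv_pres_rel] pres_class_in_carrier)
  then show ?case
    using Cons.IH xS w by (cases b) (simp_all add: a pres_class_mult)
qed

lemma (in group) word_eval_in_generate:
  "w \<in> words S \<Longrightarrow> word_eval G F w \<in> generate G (F ` S)"
proof (induction w rule: lists.induct)
  case (Cons a w)
  obtain x b where a: "a = (x, b)" by (cases a)
  have x: "F x \<in> F ` S" using Cons.hyps(1) a by blast
  have "(if b then F x else inv (F x)) \<in> generate G (F ` S)"
    by (cases b) (simp_all add: generate.incl[OF x] generate.inv[OF x])
  then show ?case using generate.eng[OF _ Cons.IH] by (simp add: a)
qed (simp add: generate.one)

lemma presented_group_generate:
  "carrier (presented_group S R)
    = generate (presented_group S R) ((\<lambda>x. pres_rel S R `` {[(x, True)]}) ` S)"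
proof
  interpret P: group "presented_group S R" by (rule presented_group_is_group)
  show "carrier (presented_group S R)
    \<subseteq> generate (presented_group S R) ((\<lambda>x. pres_rel S R `` {[(x, True)]}) ` S)"
  proof
    fix c assume "c \<in> carrier (presented_group S R)"
    then obtain w where "w \<in> words S" "c = pres_rel S R `` {w}" by (rule pres_carrierE)
    then show "c \<in> generate (presented_group S R) ((\<lambda>x. pres_rel S R `` {[(x, True)]}) ` S)"
      by (simp only: P.word_eval_in_generate flip: word_eval_presented_group)
  qed
  show "generate (presented_group S R) ((\<lambda>x. pres_rel S R `` {[(x, True)]}) ` S)
    \<subseteq> carrier (presented_group S R)"
    by (intro P.generate_incl) (auto intro: pres_class_in_carrier)
qed

lemma pres_class_relation:
  assumes "(u, v) \<in> R" "u \<in> words S" "v \<in> words S"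
  shows "pres_rel S R `` {u} = pres_rel S R `` {v}"
  using assms equiv_class_eq[OF equiv_pres_rel] pres_rel.relation by metis

lemma (in group) hom_eq_on_generate:
  assumes "f \<in> hom G H" "g \<in> hom G H" "group H" "A \<subseteq> carrier G"
    and "\<And>a. a \<in> A \<Longrightarrow> f a = g a" and "x \<in> generate G A"
  shows "f x = g x"
proof -
  interpret f: group_hom G H f using assms by (simp add: group_hom_def group_hom_axioms_def)
  interpret g: group_hom G H g using assms by (simp add: group_hom_def group_hom_axioms_def)
  from \<open>x \<in> generate G A\<close> show ?thesis
    by induction (use assms generate_in_carrier[OF assms(4)] in \<open>auto simp: subset_iff\<close>)
qed

section \<open>Conjugation and commutators\<close>

text \<open>Together with \<open>m_assoc\<close>, these rules cancel neighbouring inverse factors in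
  right-nested products; many later group identities are settled by this normalisation.\<close>

lemma (in group) mult_inv_cancel [simp]:
  assumes "x \<in> carrier G" "y \<in> carrier G"
  shows "x \<otimes> (inv x \<otimes> y) = y" and "inv x \<otimes> (x \<otimes> y) = y"
  using assms by (simp_all flip: m_assoc)

section \<open>Calculus of conjugates and commutators\<close>

lemma (in group) commutator_elt_closed [simp]:
  "x \<in> carrier G \<Longrightarrow> y \<in> carrier G \<Longrightarrow> commutator_elt G x y \<in> carrier G"
  by (simp add: commutator_elt_def)

lemma (in group) conj_act_closed [simp]:
  "x \<in> carrier G \<Longrightarrow> y \<in> carrier G \<Longrightarrow> conj_act G x y \<in> carrier G"
  by (simp add: conj_act_def)

lemma (in group) conj_act_mult:
  "x \<in> carrier G \<Longrightarrow> y \<in> carrier G \<Longrightarrow> z \<in> carrier G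
    \<Longrightarrow> conj_act G x (y \<otimes> z) = conj_act G x y \<otimes> conj_act G x z"
  by (simp add: conj_act_def m_assoc)

lemma (in group) conj_act_conj_act:
  "x \<in> carrier G \<Longrightarrow> y \<in> carrier G \<Longrightarrow> z \<in> carrier G
    \<Longrightarrow> conj_act G x (conj_act G y z) = conj_act G (x \<otimes> y) z"
  by (simp add: conj_act_def m_assoc inv_mult_group)

lemma (in group) conj_act_inv:
  "x \<in> carrier G \<Longrightarrow> y \<in> carrier G \<Longrightarrow> inv (conj_act G x y) = conj_act G x (inv y)"
  by (simp add: conj_act_def m_assoc inv_mult_group)

lemma (in group) conj_act_conj:
  "x \<in> carrier G \<Longrightarrow> y \<in> carrier G \<Longrightarrow> z \<in> carrier G
    \<Longrightarrow> conj_act G x (conj_act G y z) = conj_act G (conj_act G x y) (conj_act G x z)"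
  by (simp add: conj_act_def m_assoc inv_mult_group)

lemma (in group) conj_act_commutator:
  "x \<in> carrier G \<Longrightarrow> y \<in> carrier G \<Longrightarrow> z \<in> carrier G
    \<Longrightarrow> conj_act G x (commutator_elt G y z) = commutator_elt G (conj_act G x y) (conj_act G x z)"
  by (simp add: commutator_elt_def conj_act_mult conj_act_inv)

text \<open>Together with \<open>commutator_mult_right\<close> this says that commutators satisfy
  the tensor relations, which is why \<open>kappa\<close>, and later \<open>omega\<close>,
  exist.\<close>

lemma (in group) commutator_mult_left:
  "g \<in> carrier G \<Longrightarrow> g' \<in> carrier G \<Longrightarrow> h \<in> carrier G \<Longrightarrow>
    commutator_elt G (g \<otimes> g') h
      = commutator_elt G (conj_act G g g') (conj_act G g h) \<otimes> commutator_elt G g h"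
  by (simp flip: conj_act_commutator)
    (simp add: commutator_elt_def conj_act_def m_assoc inv_mult_group)

lemma (in group) commutator_mult_right:
  "g \<in> carrier G \<Longrightarrow> h \<in> carrier G \<Longrightarrow> h' \<in> carrier G \<Longrightarrow>
    commutator_elt G g (h \<otimes> h')
      = commutator_elt G g h \<otimes> commutator_elt G (conj_act G h g) (conj_act G h h')"
  by (simp flip: conj_act_commutator)
    (simp add: commutator_elt_def conj_act_def m_assoc inv_mult_group)

section \<open>Crossed pairings\<close>

text \<open>Common frame for the tensor square with \<open>tensor_elt\<close> and the exterior
  square with \<open>wed\<close>: the conjugates in the tensor relations are expressed through an
  action of \<open>G\<close> on the target, and identities need checking only on the generating
  pairs.\<close>

locale crossed_pairing = G: group G + W: group W
  for G (structure) and W :: "('w, 'n) monoid_scheme" +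
  fixes act :: "'a \<Rightarrow> 'w \<Rightarrow> 'w" and pair :: "'a \<Rightarrow> 'a \<Rightarrow> 'w"
  assumes pair_closed [simp]: "x \<in> carrier G \<Longrightarrow> y \<in> carrier G \<Longrightarrow> pair x y \<in> carrier W"
    and act_hom: "x \<in> carrier G \<Longrightarrow> act x \<in> hom W W"
    and act_act: "x \<in> carrier G \<Longrightarrow> y \<in> carrier G \<Longrightarrow> u \<in> carrier W
      \<Longrightarrow> act x (act y u) = act (x \<otimes> y) u"
    and act_one: "u \<in> carrier W \<Longrightarrow> act \<one> u = u"
    and act_pair: "x \<in> carrier G \<Longrightarrow> y \<in> carrier G \<Longrightarrow> z \<in> carrier G
      \<Longrightarrow> act x (pair y z) = pair (conj_act G x y) (conj_act G x z)"
    and pair_mult_left: "g \<in> carrier G \<Longrightarrow> g' \<in> carrier G \<Longrightarrow> h \<in> carrier G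
      \<Longrightarrow> pair (g \<otimes> g') h = act g (pair g' h) \<otimes>\<^bsub>W\<^esub> pair g h"
    and pair_mult_right: "g \<in> carrier G \<Longrightarrow> h \<in> carrier G \<Longrightarrow> h' \<in> carrier G
      \<Longrightarrow> pair g (h \<otimes> h') = pair g h \<otimes>\<^bsub>W\<^esub> act h (pair g h')"
    and pair_generate: "carrier W = generate W {pair x y |x y. x \<in> carrier G \<and> y \<in> carrier G}"
begin

abbreviation wmult (infixl "\<star>" 70) where "u \<star> v \<equiv> u \<otimes>\<^bsub>W\<^esub> v"

section \<open>First rules for the action and the pairing\<close>

lemma act_closed [simp]: "x \<in> carrier G \<Longrightarrow> u \<in> carrier W \<Longrightarrow> act x u \<in> carrier W"
  using act_hom by (auto simp: hom_def)

lemma act_mult: "x \<in> carrier G \<Longrightarrow> u \<in> carrier W \<Longrightarrow> v \<in> carrier W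
    \<Longrightarrow> act x (u \<star> v) = act x u \<star> act x v"
  using act_hom by (auto simp: hom_def)

lemma act_inv_act [simp]: "x \<in> carrier G \<Longrightarrow> u \<in> carrier W \<Longrightarrow> act (inv x) (act x u) = u"
  by (simp add: act_act act_one)

lemma act_act_inv [simp]: "x \<in> carrier G \<Longrightarrow> u \<in> carrier W \<Longrightarrow> act x (act (inv x) u) = u"
  by (simp add: act_act act_one)

lemma act_w_one [simp]: "x \<in> carrier G \<Longrightarrow> act x \<one>\<^bsub>W\<^esub> = \<one>\<^bsub>W\<^esub>"
  using act_hom[of x] hom_one[of "act x" W W] by (simp add: W.is_group)

lemma pair_one_left [simp]:
  assumes "h \<in> carrier G" shows "pair \<one> h = \<one>\<^bsub>W\<^esub>"
proof -
  have "pair \<one> h = pair \<one> h \<star> pair \<one> h"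
    using pair_mult_left[of \<one> \<one> h] assms by (simp add: act_one)
  then show ?thesis using assms by simp
qed

text \<open>Expanding \<open>pair (g \<otimes> g') (h \<otimes> h')\<close> in the two possible orders.\<close>

lemma pair_conj_pair:
  assumes "g \<in> carrier G" "h \<in> carrier G" "g' \<in> carrier G" "h' \<in> carrier G"
  shows "pair g h \<star> act (h \<otimes> g) (pair g' h') = act (g \<otimes> h) (pair g' h') \<star> pair g h"
proof -
  have "pair (g \<otimes> g') (h \<otimes> h')
      = act g (pair g' h) \<star> ((act (g \<otimes> h) (pair g' h') \<star> pair g h) \<star> act h (pair g h'))"
    using assms by (simp add: pair_mult_left[of g g' "h \<otimes> h'"] pair_mult_right[of g h h']
      pair_mult_right[of g' h h'] act_mult act_act W.m_assoc)
  moreover have "pair (g \<otimes> g') (h \<otimes> h')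
      = act g (pair g' h) \<star> ((pair g h \<star> act (h \<otimes> g) (pair g' h')) \<star> act h (pair g h'))"
    using assms by (simp add: pair_mult_right[of "g \<otimes> g'" h h'] pair_mult_left[of g g' h] pair_mult_left[of g g' h']
      act_mult act_act W.m_assoc)
  ultimately show ?thesis
    using assms by simp
qed

text \<open>On generators this is \<open>pair_conj_pair\<close>. Conjugation by
  \<open>pair g h\<close> after \<open>act (h \<otimes> g)\<close> and the map
  \<open>act (g \<otimes> h)\<close> are both homomorphisms, so agreement spreads to all of
  \<open>W\<close>.\<close>

lemma pair_conj:
  assumes "g \<in> carrier G" "h \<in> carrier G" "u \<in> carrier W"
  shows "pair g h \<star> act (h \<otimes> g) u = act (g \<otimes> h) u \<star> pair g h"
proof -
  let ?A = "{pair x y |x y. x \<in> carrier G \<and> y \<in> carrier G}"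
  have "u \<in> generate W ?A" using assms(3) pair_generate by simp
  then show ?thesis
  proof induction
    case one
    then show ?case using assms by simp
  next
    case (incl v)
    then show ?case using assms by (auto simp: pair_conj_pair)
  next
    case (inv v)
    then obtain x y where xy: "v = pair x y" "x \<in> carrier G" "y \<in> carrier G" by blast
    then have v: "v \<in> carrier W" by simp
    have i: "act z (inv\<^bsub>W\<^esub> v) = inv\<^bsub>W\<^esub> (act z v)" if "z \<in> carrier G" for z
      using W.is_group act_hom[OF that] v
      by (intro group_hom.hom_inv) (simp_all add: group_hom_def group_hom_axioms_def)
    \<comment> \<open>Both sides of the goal are multiplied from the left by
      \<open>act (g \<otimes> h) v\<close>, which is cancelled at the end.\<close>
    have "act (g \<otimes> h) v \<star> (pair g h \<star> act (h \<otimes> g) (inv\<^bsub>W\<^esub> v))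
        = (act (g \<otimes> h) v \<star> pair g h) \<star> inv\<^bsub>W\<^esub> (act (h \<otimes> g) v)"
      using assms v by (simp add: i W.m_assoc)
    also have "\<dots> = (pair g h \<star> act (h \<otimes> g) v) \<star> inv\<^bsub>W\<^esub> (act (h \<otimes> g) v)"
      using assms xy pair_conj_pair by simp
    also have "\<dots> = act (g \<otimes> h) v \<star> (act (g \<otimes> h) (inv\<^bsub>W\<^esub> v) \<star> pair g h)"
      using assms v by (simp add: i W.m_assoc)
    finally have "act (g \<otimes> h) v \<star> (pair g h \<star> act (h \<otimes> g) (inv\<^bsub>W\<^esub> v))
        = act (g \<otimes> h) v \<star> (act (g \<otimes> h) (inv\<^bsub>W\<^esub> v) \<star> pair g h)" .
    then show ?case using assms v by simp
  next
    case (eng v v')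
    then have v: "v \<in> carrier W" "v' \<in> carrier W" using pair_generate by simp_all
    have "pair g h \<star> act (h \<otimes> g) (v \<star> v') = (pair g h \<star> act (h \<otimes> g) v) \<star> act (h \<otimes> g) v'"
      using assms v by (simp add: act_mult W.m_assoc)
    also have "\<dots> = act (g \<otimes> h) v \<star> (pair g h \<star> act (h \<otimes> g) v')"
      using assms v eng.IH by (simp add: W.m_assoc)
    also have "\<dots> = act (g \<otimes> h) (v \<star> v') \<star> pair g h"
      using assms v eng.IH by (simp add: act_mult W.m_assoc)
    finally show ?case .
  qed
qed

text \<open>Apply \<open>pair_conj\<close> to \<open>act (inv (h \<otimes> g)) u\<close>, as
  \<open>gh\<close> times the inverse of \<open>hg\<close> is the commutator. Conjugation by a pair
  is thus the action of its commutator, the Peiffer identity of a crossed module.\<close>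

lemma pair_conj_commutator:
  assumes "g \<in> carrier G" "h \<in> carrier G" "u \<in> carrier W"
  shows "act (commutator_elt G g h) u \<star> pair g h = pair g h \<star> u"
proof -
  have "act (h \<otimes> g) (act (inv (h \<otimes> g)) u) = u"
    using assms by simp
  moreover have "act (g \<otimes> h) (act (inv (h \<otimes> g)) u) = act (commutator_elt G g h) u"
    using assms by (simp add: act_act commutator_elt_def G.inv_mult_group G.m_assoc)
  ultimately show ?thesis
    using pair_conj[of g h "act (inv (h \<otimes> g)) u"] assms by simp
qed

text \<open>Follows by computing \<open>pair g (p \<otimes> h)\<close> along two factorisations of
  \<open>p \<otimes> h\<close>, and \<open>pair g p\<close> along a factorisation of
  \<open>g\<close> that splits off the commutator.\<close>

lemma commutator_pair:
  assumes "g \<in> carrier G" "h \<in> carrier G" "p \<in> carrier G"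
  shows "pair (commutator_elt G g h) p \<star> act p (pair g h) = pair g h"
proof -
  let ?k = "commutator_elt G g h" and ?t = "pair g h" and ?v = "pair (conj_act G h g) p"
  \<comment> \<open>Writing \<open>p \<otimes> h\<close> also as \<open>h\<close> times a conjugate
    of \<open>p\<close> turns the second term of the expansion into \<open>?v\<close>.\<close>
  have "h \<otimes> (inv h \<otimes> p \<otimes> h) = p \<otimes> h" "conj_act G h (inv h \<otimes> p \<otimes> h) = p"
    using assms by (simp_all add: conj_act_def G.m_assoc)
  then have "?t \<star> ?v = pair g p \<star> act p ?t"
    using assms pair_mult_right[of g h "inv h \<otimes> p \<otimes> h"] pair_mult_right[of g p h]
    by (simp add: act_pair)
  \<comment> \<open>The commutator is split off \<open>g\<close>, so that \<open>pair ?k p\<close>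
    appears.\<close>
  moreover have "g = ?k \<otimes> conj_act G h g"
    using assms by (simp add: commutator_elt_def conj_act_def G.m_assoc)
  then have "pair g p = act ?k ?v \<star> pair ?k p"
    using assms pair_mult_left[of ?k "conj_act G h g" p] by simp
  moreover have "act ?k ?v \<star> ?t = ?t \<star> ?v"
    using assms by (simp add: pair_conj_commutator)
  ultimately have "act ?k ?v \<star> (pair ?k p \<star> act p ?t) = act ?k ?v \<star> ?t"
    using assms by (simp add: W.m_assoc)
  then show ?thesis using assms by simp
qed

text \<open>Compare the expansions of \<open>pair (x \<otimes> y) p\<close> and
  \<open>pair (y \<otimes> x) p\<close>; as \<open>x \<otimes> y\<close> is the commutator times
  \<open>y \<otimes> x\<close>, their discrepancy is governed by
  \<open>commutator_pair\<close>.\<close>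

lemma pair_exchange_aux:
  assumes "x \<in> carrier G" "y \<in> carrier G" "p \<in> carrier G"
  shows "act x (pair y p) \<star> pair x (p \<otimes> y) = pair x (y \<otimes> p) \<star> pair y p"
proof -
  let ?k = "commutator_elt G x y" and ?v = "pair (y \<otimes> x) p"
  have "x \<otimes> y = ?k \<otimes> (y \<otimes> x)"
    using assms by (simp add: commutator_elt_def G.m_assoc)
  then have "pair (x \<otimes> y) p = act ?k ?v \<star> pair ?k p"
    using assms pair_mult_left[of ?k "y \<otimes> x" p] by simp
  then have "pair (x \<otimes> y) p \<star> act p (pair x y) = pair x y \<star> ?v"
    using assms by (simp add: W.m_assoc commutator_pair pair_conj_commutator)
  then show ?thesis
    using assms by (simp add: pair_mult_left pair_mult_right W.m_assoc)
qed

text \<open>The form needed for normal forms: \<open>p\<close> is the part of an ordered product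
  before \<open>y\<close> and \<open>w\<close> the part after it. The tail \<open>w\<close> is moved
  through by \<open>pair_conj\<close>.\<close>

lemma pair_exchange:
  assumes "x \<in> carrier G" "y \<in> carrier G" "p \<in> carrier G" "w \<in> carrier G"
  shows "act x (pair y p) \<star> pair x (p \<otimes> (y \<otimes> w)) = pair x (y \<otimes> (p \<otimes> w)) \<star> pair y p"
proof -
  have "act x (pair y p) \<star> pair x ((p \<otimes> y) \<otimes> w)
      = (act x (pair y p) \<star> pair x (p \<otimes> y)) \<star> act (p \<otimes> y) (pair x w)"
    using assms by (simp add: pair_mult_right[of x "p \<otimes> y" w] W.m_assoc)
  also have "\<dots> = pair x (y \<otimes> p) \<star> (pair y p \<star> act (p \<otimes> y) (pair x w))"
    using assms by (simp add: pair_exchange_aux W.m_assoc)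
  also have "\<dots> = (pair x (y \<otimes> p) \<star> act (y \<otimes> p) (pair x w)) \<star> pair y p"
    using assms by (simp add: pair_conj W.m_assoc)
  also have "\<dots> = pair x ((y \<otimes> p) \<otimes> w) \<star> pair y p"
    using assms by (simp add: pair_mult_right[of x "y \<otimes> p" w])
  finally show ?thesis using assms by (simp add: G.m_assoc)
qed

text \<open>A power of \<open>x\<close> fixes \<open>x\<close> under conjugation, so every expansion
  step contributes another factor \<open>pair x x\<close>. This transfers torsion from
  \<open>G\<close> to the diagonal.\<close>

lemma pair_pow:
  assumes "x \<in> carrier G"
  shows "pair (x [^] (n::nat)) x = pair x x [^]\<^bsub>W\<^esub> n"
proof (induction n)
  case (Suc n)
  have "x [^] n \<otimes> x = x \<otimes> x [^] n"
    using assms G.nat_pow_comm[of x n 1] by simp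
  then have "conj_act G (x [^] n) x = x"
    using assms by (simp add: conj_act_def G.m_assoc)
  then show ?case
    using assms Suc pair_mult_left[of "x [^] n" x x] W.nat_pow_Suc2[of "pair x x" n]
    by (simp add: act_pair)
qed (use assms in simp)

end

locale alternating_pairing = crossed_pairing +
  assumes pair_self: "x \<in> carrier G \<Longrightarrow> pair x x = \<one>\<^bsub>W\<^esub>"
begin

text \<open>Expand the trivial element \<open>pair (y \<otimes> x) (y \<otimes> x)\<close> in both
  arguments; what is left is the image of the product under the injective map
  \<open>act y\<close>.\<close>

lemma pair_swap:
  assumes "x \<in> carrier G" "y \<in> carrier G"
  shows "pair x y \<star> pair y x = \<one>\<^bsub>W\<^esub>"
proof -
  have "act y (pair x y \<star> pair y x) = pair (y \<otimes> x) (y \<otimes> x)"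
    using assms pair_mult_left[of y x "y \<otimes> x"] pair_mult_right[of _ y x]
    by (simp add: pair_self act_mult)
  then have "act y (pair x y \<star> pair y x) = \<one>\<^bsub>W\<^esub>"
    using assms by (simp add: pair_self)
  then have "act (inv y) (act y (pair x y \<star> pair y x)) = \<one>\<^bsub>W\<^esub>"
    using assms by simp
  then show ?thesis
    using assms by simp
qed

end

section \<open>The permutation representation\<close>

locale ordered_pairing = alternating_pairing G W act pair + ord: linorder le lt
  for G :: "('a, 'm) monoid_scheme" (structure) and W :: "('w, 'n) monoid_scheme" and act pair
    and le lt :: "'a \<Rightarrow> 'a \<Rightarrow> bool"
begin

definition oprod :: "'a set \<Rightarrow> ('a \<Rightarrow>\<^sub>0 int) \<Rightarrow> 'a" where
  "oprod S a = foldr (\<lambda>y z. y [^] Poly_Mapping.lookup a y \<otimes> z)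
     (ord.sorted_list_of_set (S \<inter> Poly_Mapping.keys a \<inter> carrier G)) \<one>"

section \<open>Ordered products of powers and their prefixes\<close>

lemma foldr_mult_closed:
  "set xs \<subseteq> carrier G \<Longrightarrow> foldr (\<lambda>y z. y [^] (n y :: int) \<otimes> z) xs \<one> \<in> carrier G"
  by (induction xs) auto

lemma foldr_mult_append:
  "set xs \<subseteq> carrier G \<Longrightarrow> set ys \<subseteq> carrier G \<Longrightarrow>
    foldr (\<lambda>y z. y [^] (n y :: int) \<otimes> z) (xs @ ys) \<one>
      = foldr (\<lambda>y z. y [^] n y \<otimes> z) xs \<one> \<otimes> foldr (\<lambda>y z. y [^] n y \<otimes> z) ys \<one>"
  by (induction xs) (simp_all add: foldr_mult_closed G.m_assoc del: foldr_append)

lemma oprod_closed [simp]: "oprod S a \<in> carrier G"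
  unfolding oprod_def by (rule foldr_mult_closed) simp

lemma oprod_cong:
  assumes "\<And>y. y \<in> S \<Longrightarrow> Poly_Mapping.lookup a y = Poly_Mapping.lookup b y"
  shows "oprod S a = oprod S b"
proof -
  have "S \<inter> Poly_Mapping.keys a = S \<inter> Poly_Mapping.keys b"
    using assms by (auto simp: in_keys_iff)
  then show ?thesis
    unfolding oprod_def using assms by (auto intro!: foldr_cong)
qed

lemma oprod_single:
  assumes "y \<in> carrier G"
  shows "oprod {y} a = y [^] Poly_Mapping.lookup a y"
proof (cases "y \<in> Poly_Mapping.keys a")
  case True
  then have "{y} \<inter> Poly_Mapping.keys a \<inter> carrier G = {y}" using assms by auto
  then show ?thesis using assms by (simp add: oprod_def)
next
  case False
  then have "{y} \<inter> Poly_Mapping.keys a \<inter> carrier G = {}" by auto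
  then show ?thesis using False by (simp add: oprod_def in_keys_iff)
qed

text \<open>As \<open>S\<close> lies entirely below \<open>T\<close>, the sorted list of the union
  is the concatenation of the two sorted lists.\<close>

lemma oprod_Un:
  assumes "\<And>y z. y \<in> S \<Longrightarrow> z \<in> T \<Longrightarrow> lt y z"
  shows "oprod (S \<union> T) a = oprod S a \<otimes> oprod T a"
proof -
  let ?K = "Poly_Mapping.keys a \<inter> carrier G"
  let ?l = "\<lambda>S. ord.sorted_list_of_set (S \<inter> Poly_Mapping.keys a \<inter> carrier G)"
  have "?l (S \<union> T) = ?l S @ ?l T"
  proof (rule ord.sorted_distinct_set_unique)
    show "sorted_wrt le (?l S @ ?l T)"
      using assms by (auto simp: sorted_wrt_append ord.sorted_sorted_list_of_set intro: ord.less_imp_le)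
    show "distinct (?l S @ ?l T)"
      using assms by (auto simp: ord.distinct_sorted_list_of_set)
    show "set (?l (S \<union> T)) = set (?l S @ ?l T)"
      by auto
  qed (simp_all add: ord.sorted_sorted_list_of_set ord.distinct_sorted_list_of_set)
  then show ?thesis
    unfolding oprod_def by (simp add: foldr_mult_append del: foldr_append)
qed

text \<open>These are the factors that a new \<open>x\<close>, entering an ordered product from the
  left, has to pass before it joins the power of \<open>x\<close>.\<close>

definition pre :: "'a \<Rightarrow> ('a \<Rightarrow>\<^sub>0 int) \<Rightarrow> 'a" where
  "pre x a = oprod {y. lt y x} a"

lemma pre_closed [simp]: "pre x a \<in> carrier G"
  by (simp add: pre_def)

lemma pre_add_ge: "\<not> lt y x \<Longrightarrow> pre x (a + frag_of y) = pre x a"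
  unfolding pre_def by (rule oprod_cong) (auto simp: lookup_add)

lemma pre_split:
  assumes "lt y x" "y \<in> carrier G"
  shows "pre x a = pre y a \<otimes> (y [^] Poly_Mapping.lookup a y \<otimes> oprod {z. lt y z \<and> lt z x} a)"
proof -
  have "{z. lt z x} = {z. lt z y} \<union> ({y} \<union> {z. lt y z \<and> lt z x})"
    using assms by (auto intro: ord.less_trans)
  moreover have "oprod ({z. lt z y} \<union> ({y} \<union> {z. lt y z \<and> lt z x})) a
      = pre y a \<otimes> oprod ({y} \<union> {z. lt y z \<and> lt z x}) a"
    unfolding pre_def by (rule oprod_Un) (auto intro: ord.less_trans)
  moreover have "oprod ({y} \<union> {z. lt y z \<and> lt z x}) a = oprod {y} a \<otimes> oprod {z. lt y z \<and> lt z x} a"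
    by (rule oprod_Un) auto
  ultimately show ?thesis using assms by (simp add: pre_def oprod_single)
qed

text \<open>Supplies the shape required by \<open>pair_exchange\<close>: raising the exponent of
  \<open>y\<close> inserts one \<open>y\<close> directly after the prefix \<open>p\<close>.\<close>

lemma pre_add_less:
  assumes "lt y x" "y \<in> carrier G"
  obtains p w where "p = pre y a" "w \<in> carrier G"
    "pre x a = p \<otimes> w" "pre x (a + frag_of y) = p \<otimes> (y \<otimes> w)"
proof
  let ?r = "\<lambda>a. oprod {z. lt y z \<and> lt z x} a"
  let ?w = "y [^] Poly_Mapping.lookup a y \<otimes> ?r a"
  show "?w \<in> carrier G" using assms by simp
  show "pre x a = pre y a \<otimes> ?w" using assms by (rule pre_split)
  have "?r (a + frag_of y) = ?r a"
    by (rule oprod_cong) (auto simp: lookup_add)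
  \<comment> \<open>With the 1 on the left, \<open>int_pow_mult\<close> splits the new
    \<open>y\<close> off in front of the old power.\<close>
  moreover have "Poly_Mapping.lookup (a + frag_of y) y = 1 + Poly_Mapping.lookup a y"
    by (simp add: lookup_add)
  ultimately show "pre x (a + frag_of y) = pre y a \<otimes> (y \<otimes> ?w)"
    using assms pre_split[OF assms, of "a + frag_of y"]
    by (simp add: pre_add_ge G.int_pow_mult G.m_assoc)
qed simp

section \<open>Permutations of the normal forms\<close>

definition Omega :: "('w \<times> ('a \<Rightarrow>\<^sub>0 int)) set" where
  "Omega = carrier W \<times> UNIV"

definition Lperm :: "'w \<Rightarrow> 'w \<times> ('a \<Rightarrow>\<^sub>0 int) \<Rightarrow> 'w \<times> ('a \<Rightarrow>\<^sub>0 int)" where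
  "Lperm t = (\<lambda>(u, a)\<in>Omega. (t \<star> u, a))"

text \<open>Left multiplication by \<open>x\<close> on normal forms: passing \<open>u\<close> turns
  it into \<open>act x u\<close>, passing the prefix \<open>pre x a\<close> costs the commutator
  \<open>pair x (pre x a)\<close>, and then the exponent of \<open>x\<close> grows by one.\<close>

definition Pperm :: "'a \<Rightarrow> 'w \<times> ('a \<Rightarrow>\<^sub>0 int) \<Rightarrow> 'w \<times> ('a \<Rightarrow>\<^sub>0 int)" where
  "Pperm x = (\<lambda>(u, a)\<in>Omega. (act x u \<star> pair x (pre x a), a + frag_of x))"

lemma Lperm_Bij: "t \<in> carrier W \<Longrightarrow> Lperm t \<in> Bij Omega"
  unfolding Bij_def
proof (intro IntI CollectI)
  assume t: "t \<in> carrier W"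
  show "bij_betw (Lperm t) Omega Omega"
    by (rule bij_betw_byWitness[where f' = "\<lambda>(u, a). (inv\<^bsub>W\<^esub> t \<star> u, a)"])
      (use t in \<open>auto simp: Lperm_def Omega_def\<close>)
qed (simp add: Lperm_def)

lemma Pperm_Bij: "x \<in> carrier G \<Longrightarrow> Pperm x \<in> Bij Omega"
  unfolding Bij_def
proof (intro IntI CollectI)
  assume x: "x \<in> carrier G"
  \<comment> \<open>The prefix lies strictly below \<open>x\<close> and so ignores the exponent of
    \<open>x\<close>; hence the inverse can be computed from the new exponents.\<close>
  have pre: "pre x (a - frag_of x) = pre x a" for a
    using pre_add_ge[of x x "a - frag_of x"] by simp
  show "bij_betw (Pperm x) Omega Omega"
    by (rule bij_betw_byWitness[where
        f' = "\<lambda>(u, a). (act (inv x) (u \<star> inv\<^bsub>W\<^esub> (pair x (pre x a))), a - frag_of x)"])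
      (use x in \<open>auto simp: Pperm_def Omega_def pre pre_add_ge W.m_assoc\<close>)
qed (simp add: Pperm_def)

abbreviation Perm where "Perm \<equiv> BijGroup Omega"

lemma Perm_eqI:
  assumes "f \<in> Bij Omega" "g \<in> Bij Omega" "\<And>u a. u \<in> carrier W \<Longrightarrow> f (u, a) = g (u, a)"
  shows "f = g"
  by (rule extensionalityI[of _ Omega]) (use assms in \<open>auto simp: Bij_def Omega_def\<close>)

lemma Perm_mult: "f \<in> Bij Omega \<Longrightarrow> g \<in> Bij Omega \<Longrightarrow> f \<otimes>\<^bsub>Perm\<^esub> g = compose Omega f g"
  by (simp add: BijGroup_def)

lemma Lperm_apply [simp]: "u \<in> carrier W \<Longrightarrow> Lperm t (u, a) = (t \<star> u, a)"
  by (simp add: Lperm_def Omega_def)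

lemma Pperm_apply [simp]:
  "u \<in> carrier W \<Longrightarrow> Pperm x (u, a) = (act x u \<star> pair x (pre x a), a + frag_of x)"
  by (simp add: Pperm_def Omega_def)

lemma compose_apply: "u \<in> carrier W \<Longrightarrow> compose Omega f g (u, a) = f (g (u, a))"
  by (simp add: compose_def Omega_def)

lemmas perm_simps = Perm_mult compose_apply compose_Bij Lperm_Bij Pperm_Bij

lemma Lperm_hom: "Lperm \<in> hom W Perm"
proof (rule homI)
  fix s t assume st: "s \<in> carrier W" "t \<in> carrier W"
  show "Lperm (s \<star> t) = Lperm s \<otimes>\<^bsub>Perm\<^esub> Lperm t"
    by (rule Perm_eqI) (use st in \<open>simp_all add: perm_simps W.m_assoc\<close>)
qed (simp add: BijGroup_def Lperm_Bij)

text \<open>Evaluation at the normal form of the identity recovers \<open>t\<close>. This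
  faithfulness is what bounds the kernel of \<open>omega\<close>.\<close>

lemma Lperm_inj: "inj_on Lperm (carrier W)"
proof (rule inj_onI)
  fix s t assume st: "s \<in> carrier W" "t \<in> carrier W" and "Lperm s = Lperm t"
  then have "Lperm s (\<one>\<^bsub>W\<^esub>, 0) = Lperm t (\<one>\<^bsub>W\<^esub>, 0)" by (rule_tac fun_cong)
  then show "s = t" using st by simp
qed

lemma Pperm_Lperm:
  assumes "x \<in> carrier G" "t \<in> carrier W"
  shows "Pperm x \<otimes>\<^bsub>Perm\<^esub> Lperm t = Lperm (act x t) \<otimes>\<^bsub>Perm\<^esub> Pperm x"
  by (rule Perm_eqI) (use assms in \<open>simp_all add: perm_simps act_mult W.m_assoc\<close>)

text \<open>For \<open>y\<close> below \<open>x\<close>, adding \<open>y\<close> changes the prefix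
  of \<open>x\<close> from \<open>p \<otimes> w\<close> to
  \<open>p \<otimes> (y \<otimes> w)\<close>, while adding \<open>x\<close> leaves the prefix
  \<open>p\<close> of \<open>y\<close> alone. The discrepancy is handled by
  \<open>pair_exchange\<close> and then \<open>pair_conj\<close>.\<close>

lemma Pperm_Pperm_less:
  assumes "lt y x" "x \<in> carrier G" "y \<in> carrier G"
  shows "Pperm x \<otimes>\<^bsub>Perm\<^esub> Pperm y
    = Lperm (pair x y) \<otimes>\<^bsub>Perm\<^esub> (Pperm y \<otimes>\<^bsub>Perm\<^esub> Pperm x)"
proof (rule Perm_eqI)
  fix u and a :: "'a \<Rightarrow>\<^sub>0 int" assume u: "u \<in> carrier W"
  from assms(1,3) obtain p w where pw: "p = pre y a" "w \<in> carrier G"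
    "pre x a = p \<otimes> w" "pre x (a + frag_of y) = p \<otimes> (y \<otimes> w)"
    by (rule pre_add_less)
  then have [simp]: "p \<in> carrier G" by simp
  have py: "pre y (a + frag_of x) = p"
    using assms(1) pw(1) by (auto intro!: pre_add_ge dest: ord.less_not_sym)
  have "act x (act y u \<star> pair y p) \<star> pair x (p \<otimes> (y \<otimes> w))
      = act (x \<otimes> y) u \<star> (act x (pair y p) \<star> pair x (p \<otimes> (y \<otimes> w)))"
    using assms u pw(2) by (simp add: act_mult act_act W.m_assoc)
  also have "\<dots> = act (x \<otimes> y) u \<star> (pair x (y \<otimes> (p \<otimes> w)) \<star> pair y p)"
    using assms pw(2) by (simp only: pair_exchange \<open>p \<in> carrier G\<close>)
  also have "\<dots> = (act (x \<otimes> y) u \<star> pair x y) \<star> (act y (pair x (p \<otimes> w)) \<star> pair y p)"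
    using assms u pw(2) by (simp add: pair_mult_right[of x y] W.m_assoc)
  also have "\<dots> = (pair x y \<star> act (y \<otimes> x) u) \<star> (act y (pair x (p \<otimes> w)) \<star> pair y p)"
    using assms u by (simp add: pair_conj)
  also have "\<dots> = pair x y \<star> (act y (act x u \<star> pair x (p \<otimes> w)) \<star> pair y p)"
    using assms u pw(2) by (simp add: act_mult act_act W.m_assoc)
  finally show "(Pperm x \<otimes>\<^bsub>Perm\<^esub> Pperm y) (u, a)
    = (Lperm (pair x y) \<otimes>\<^bsub>Perm\<^esub> (Pperm y \<otimes>\<^bsub>Perm\<^esub> Pperm x)) (u, a)"
    using assms u pw py by (simp add: perm_simps add_ac)
qed (use assms in \<open>simp_all add: perm_simps\<close>)

text \<open>For \<open>x = y\<close> the pairing is trivial; for \<open>x\<close> below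
  \<open>y\<close> the preceding lemma is turned round by \<open>pair_swap\<close>.\<close>

lemma Pperm_Pperm:
  assumes "x \<in> carrier G" "y \<in> carrier G"
  shows "Pperm x \<otimes>\<^bsub>Perm\<^esub> Pperm y
    = Lperm (pair x y) \<otimes>\<^bsub>Perm\<^esub> (Pperm y \<otimes>\<^bsub>Perm\<^esub> Pperm x)"
proof -
  interpret B: group Perm by (rule group_BijGroup)
  have c: "\<And>z. z \<in> carrier G \<Longrightarrow> Pperm z \<in> carrier Perm"
    "\<And>t. t \<in> carrier W \<Longrightarrow> Lperm t \<in> carrier Perm"
    by (simp_all add: BijGroup_def Lperm_Bij Pperm_Bij)
  have L1: "Lperm \<one>\<^bsub>W\<^esub> = \<one>\<^bsub>Perm\<^esub>"
    using hom_one[OF Lperm_hom W.is_group B.is_group] .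
  consider "lt y x" | "x = y" | "lt x y" using ord.neqE by blast
  then show ?thesis
  proof cases
    case 1
    then show ?thesis using assms by (rule Pperm_Pperm_less)
  next
    case 2
    then show ?thesis using assms c by (simp add: pair_self L1)
  next
    case 3
    have "Lperm (pair x y) \<otimes>\<^bsub>Perm\<^esub> (Pperm y \<otimes>\<^bsub>Perm\<^esub> Pperm x)
        = Lperm (pair x y) \<otimes>\<^bsub>Perm\<^esub> (Lperm (pair y x) \<otimes>\<^bsub>Perm\<^esub> (Pperm x \<otimes>\<^bsub>Perm\<^esub> Pperm y))"
      using Pperm_Pperm_less[OF 3 assms(2,1)] by simp
    also have "\<dots> = Lperm (pair x y \<star> pair y x) \<otimes>\<^bsub>Perm\<^esub> (Pperm x \<otimes>\<^bsub>Perm\<^esub> Pperm y)"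
      using assms c by (simp add: hom_mult[OF Lperm_hom] B.m_assoc)
    also have "\<dots> = Pperm x \<otimes>\<^bsub>Perm\<^esub> Pperm y"
      using assms c by (simp add: pair_swap L1)
    finally show ?thesis by simp
  qed
qed

lemma Perm_group: "group Perm"
  by (rule group_BijGroup)

lemma Perm_closed [simp]: "x \<in> carrier G \<Longrightarrow> Pperm x \<in> carrier Perm"
  "t \<in> carrier W \<Longrightarrow> Lperm t \<in> carrier Perm"
  by (simp_all add: BijGroup_def Lperm_Bij Pperm_Bij)

text \<open>\<open>Pperm x\<close> passes the product of \<open>Pperm g\<close> and
  \<open>Pperm h\<close> at the same cost \<open>Lperm s\<close> as it passes
  \<open>Pperm (g \<otimes> h)\<close>, and the defect \<open>z\<close> commutes with
  \<open>Lperm s\<close>. So \<open>z\<close> can serve as the value of a central cocycle.\<close>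

lemma Pperm_defect_commute:
  assumes "g \<in> carrier G" "h \<in> carrier G" "x \<in> carrier G"
  defines "z \<equiv> Pperm g \<otimes>\<^bsub>Perm\<^esub> Pperm h \<otimes>\<^bsub>Perm\<^esub> inv\<^bsub>Perm\<^esub> (Pperm (g \<otimes> h))"
  shows "z \<otimes>\<^bsub>Perm\<^esub> Pperm x = Pperm x \<otimes>\<^bsub>Perm\<^esub> z"
proof -
  interpret Q: group Perm by (rule Perm_group)
  \<comment> \<open>\<open>t\<close> is the preimage of \<open>s\<close> under the action of
    \<open>g \<otimes> h\<close>, so that both \<open>k\<close> and \<open>m\<close> turn
    \<open>Lperm t\<close> into \<open>l\<close> when moved across it.\<close>
  define s t l k m where "s = pair x (g \<otimes> h)" and "t = act (inv (g \<otimes> h)) s"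
    and "l = Lperm s" and "k = Pperm g \<otimes>\<^bsub>Perm\<^esub> Pperm h" and "m = Pperm (g \<otimes> h)"
  note defs = s_def t_def l_def k_def m_def
  have s: "s \<in> carrier W" "t \<in> carrier W" "act (g \<otimes> h) t = s"
    using assms by (simp_all add: s_def t_def)
  have c: "l \<in> carrier Perm" "k \<in> carrier Perm" "m \<in> carrier Perm" "Pperm x \<in> carrier Perm"
    "Lperm t \<in> carrier Perm"
    using assms s by (simp_all add: l_def k_def m_def)
  have z: "z = k \<otimes>\<^bsub>Perm\<^esub> inv\<^bsub>Perm\<^esub> m"
    by (simp add: z_def k_def m_def)
  have "Pperm x \<otimes>\<^bsub>Perm\<^esub> k = (Lperm (pair x g) \<otimes>\<^bsub>Perm\<^esub> (Pperm g \<otimes>\<^bsub>Perm\<^esub> Pperm x)) \<otimes>\<^bsub>Perm\<^esub> Pperm h"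
    using assms by (simp add: k_def Q.m_assoc flip: Pperm_Pperm[of x g])
  also have "\<dots> = Lperm (pair x g) \<otimes>\<^bsub>Perm\<^esub> (Pperm g \<otimes>\<^bsub>Perm\<^esub> (Lperm (pair x h) \<otimes>\<^bsub>Perm\<^esub> (Pperm h \<otimes>\<^bsub>Perm\<^esub> Pperm x)))"
    using assms by (simp add: Q.m_assoc flip: Pperm_Pperm[of x h])
  also have "\<dots> = Lperm (pair x g) \<otimes>\<^bsub>Perm\<^esub> ((Pperm g \<otimes>\<^bsub>Perm\<^esub> Lperm (pair x h)) \<otimes>\<^bsub>Perm\<^esub> (Pperm h \<otimes>\<^bsub>Perm\<^esub> Pperm x))"
    using assms by (simp add: Q.m_assoc)
  also have "\<dots> = (Lperm (pair x g) \<otimes>\<^bsub>Perm\<^esub> Lperm (act g (pair x h))) \<otimes>\<^bsub>Perm\<^esub> k \<otimes>\<^bsub>Perm\<^esub> Pperm x"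
    using assms by (simp add: Pperm_Lperm k_def Q.m_assoc)
  also have "Lperm (pair x g) \<otimes>\<^bsub>Perm\<^esub> Lperm (act g (pair x h)) = l"
    using assms by (simp add: l_def s_def pair_mult_right hom_mult[OF Lperm_hom])
  finally have xk: "Pperm x \<otimes>\<^bsub>Perm\<^esub> k = l \<otimes>\<^bsub>Perm\<^esub> k \<otimes>\<^bsub>Perm\<^esub> Pperm x" .
  have "Pperm x \<otimes>\<^bsub>Perm\<^esub> m = l \<otimes>\<^bsub>Perm\<^esub> (m \<otimes>\<^bsub>Perm\<^esub> Pperm x)"
    unfolding l_def m_def s_def by (rule Pperm_Pperm) (use assms in simp_all)
  then have "inv\<^bsub>Perm\<^esub> m \<otimes>\<^bsub>Perm\<^esub> (inv\<^bsub>Perm\<^esub> l \<otimes>\<^bsub>Perm\<^esub> (Pperm x \<otimes>\<^bsub>Perm\<^esub> m)) \<otimes>\<^bsub>Perm\<^esub> inv\<^bsub>Perm\<^esub> m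
      = Pperm x \<otimes>\<^bsub>Perm\<^esub> inv\<^bsub>Perm\<^esub> m"
    using c by simp
  then have xm: "Pperm x \<otimes>\<^bsub>Perm\<^esub> inv\<^bsub>Perm\<^esub> m = inv\<^bsub>Perm\<^esub> m \<otimes>\<^bsub>Perm\<^esub> (inv\<^bsub>Perm\<^esub> l \<otimes>\<^bsub>Perm\<^esub> Pperm x)"
    using c by (simp add: Q.m_assoc)
  have "k \<otimes>\<^bsub>Perm\<^esub> Lperm t = Pperm g \<otimes>\<^bsub>Perm\<^esub> (Pperm h \<otimes>\<^bsub>Perm\<^esub> Lperm t)"
    using assms c by (simp add: k_def Q.m_assoc)
  also have "\<dots> = (Pperm g \<otimes>\<^bsub>Perm\<^esub> Lperm (act h t)) \<otimes>\<^bsub>Perm\<^esub> Pperm h"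
    using assms s by (simp add: Pperm_Lperm[of h t] Q.m_assoc)
  also have "\<dots> = l \<otimes>\<^bsub>Perm\<^esub> k"
    using assms s by (simp add: Pperm_Lperm act_act k_def l_def Q.m_assoc)
  finally have kt: "k \<otimes>\<^bsub>Perm\<^esub> Lperm t = l \<otimes>\<^bsub>Perm\<^esub> k" .
  have mt: "m \<otimes>\<^bsub>Perm\<^esub> Lperm t = l \<otimes>\<^bsub>Perm\<^esub> m"
    using assms s by (simp add: Pperm_Lperm m_def l_def)
  have "z \<otimes>\<^bsub>Perm\<^esub> l = k \<otimes>\<^bsub>Perm\<^esub> (inv\<^bsub>Perm\<^esub> m \<otimes>\<^bsub>Perm\<^esub> (l \<otimes>\<^bsub>Perm\<^esub> m)) \<otimes>\<^bsub>Perm\<^esub> inv\<^bsub>Perm\<^esub> m"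
    using c by (simp add: z Q.m_assoc)
  also have "\<dots> = (k \<otimes>\<^bsub>Perm\<^esub> Lperm t) \<otimes>\<^bsub>Perm\<^esub> inv\<^bsub>Perm\<^esub> m"
    using c by (simp flip: mt)
  also have "\<dots> = l \<otimes>\<^bsub>Perm\<^esub> z"
    using c by (simp add: kt z Q.m_assoc)
  finally have zl: "z \<otimes>\<^bsub>Perm\<^esub> l = l \<otimes>\<^bsub>Perm\<^esub> z" .
  have zc: "z \<in> carrier Perm" using c by (simp add: z)
  \<comment> \<open>Passing \<open>k\<close> produces \<open>l\<close> on the left and passing the
    inverse of \<open>m\<close> produces the inverse of \<open>l\<close>; by \<open>zl\<close> the
    two cancel around \<open>z\<close>.\<close>
  have "Pperm x \<otimes>\<^bsub>Perm\<^esub> z = (Pperm x \<otimes>\<^bsub>Perm\<^esub> k) \<otimes>\<^bsub>Perm\<^esub> inv\<^bsub>Perm\<^esub> m"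
    using c by (simp add: z Q.m_assoc)
  also have "\<dots> = l \<otimes>\<^bsub>Perm\<^esub> k \<otimes>\<^bsub>Perm\<^esub> (Pperm x \<otimes>\<^bsub>Perm\<^esub> inv\<^bsub>Perm\<^esub> m)"
    using c by (simp add: xk Q.m_assoc)
  also have "\<dots> = (l \<otimes>\<^bsub>Perm\<^esub> z) \<otimes>\<^bsub>Perm\<^esub> (inv\<^bsub>Perm\<^esub> l \<otimes>\<^bsub>Perm\<^esub> Pperm x)"
    using c by (simp add: xm z Q.m_assoc)
  also have "\<dots> = z \<otimes>\<^bsub>Perm\<^esub> Pperm x"
    using c zc by (simp add: Q.m_assoc flip: zl)
  finally show ?thesis by simp
qed

lemma commutator_Pperm:
  assumes "x \<in> carrier G" "y \<in> carrier G"
  shows "commutator_elt Perm (Pperm x) (Pperm y) = Lperm (pair x y)"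
proof -
  interpret Q: group Perm by (rule Perm_group)
  have "commutator_elt Perm (Pperm x) (Pperm y)
      = (Pperm x \<otimes>\<^bsub>Perm\<^esub> Pperm y) \<otimes>\<^bsub>Perm\<^esub> inv\<^bsub>Perm\<^esub> (Pperm x) \<otimes>\<^bsub>Perm\<^esub> inv\<^bsub>Perm\<^esub> (Pperm y)"
    by (simp add: commutator_elt_def)
  also have "\<dots> = Lperm (pair x y)"
    using assms by (subst Pperm_Pperm) (simp_all add: Q.m_assoc)
  finally show ?thesis .
qed

end

text \<open>Ordered products need a linear order on the type of elements; the well-ordering theorem
  supplies one.\<close>

lemma ex_linorder: "\<exists>le lt :: 'a \<Rightarrow> 'a \<Rightarrow> bool. class.linorder le lt"
proof -
  obtain r :: "'a rel" where r: "well_order_on UNIV r"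
    using well_order_on by blast
  define le where "le x y \<longleftrightarrow> (x, y) \<in> r" for x y
  have lin: "refl r" "trans r" "antisym r" "total r"
    using r by (simp_all add: well_order_on_def linear_order_on_def partial_order_on_def
        preorder_on_def)
  then have "(x, y) \<in> r \<or> (y, x) \<in> r" for x y
    by (cases "x = y") (auto simp: refl_on_def total_on_def)
  with lin(1-3) have "class.linorder le (\<lambda>x y. le x y \<and> x \<noteq> y)"
    unfolding le_def
    by unfold_locales (auto simp: refl_on_def dest: antisymD transD)
  then show ?thesis by blast
qed

section \<open>The tensor square\<close>

lemma (in group) central_subgroup_normal:
  assumes "subgroup N G" "\<And>n x. n \<in> N \<Longrightarrow> x \<in> carrier G \<Longrightarrow> x \<otimes> n = n \<otimes> x"
  shows "N \<lhd> G"
  unfolding normal_inv_iff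
proof (intro conjI ballI)
  fix x h assume "x \<in> carrier G" "h \<in> N"
  then show "x \<otimes> h \<otimes> inv x \<in> N"
    using assms subgroup.mem_carrier[OF assms(1)] by (simp add: m_assoc)
qed (rule assms)

locale tensor_group = group G for G (structure)
begin

abbreviation T where "T \<equiv> tensor_square G"
abbreviation tens where "tens \<equiv> tensor_elt G"

section \<open>Generators and universal property of the tensor square\<close>

lemma T_group: "group T"
  unfolding tensor_square_def by (rule presented_group_is_group)

lemma tens_closed: "x \<in> carrier G \<Longrightarrow> y \<in> carrier G \<Longrightarrow> tens x y \<in> carrier T"
  unfolding tensor_square_def tensor_elt_def by (rule pres_class_in_carrier) simp

lemma tens_mult_left:
  assumes "g \<in> carrier G" "g' \<in> carrier G" "h \<in> carrier G"
  shows "tens (g \<otimes> g') h = tens (conj_act G g g') (conj_act G g h) \<otimes>\<^bsub>T\<^esub> tens g h"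
proof -
  have "([((g \<otimes> g', h), True)], [((conj_act G g g', conj_act G g h), True), ((g, h), True)])
      \<in> tensor_relations G"
    using assms unfolding tensor_relations_def by blast
  from pres_class_relation[OF this, of "carrier G \<times> carrier G"] show ?thesis
    using assms by (simp add: tensor_square_def tensor_elt_def pres_class_mult)
qed

lemma tens_mult_right:
  assumes "g \<in> carrier G" "h \<in> carrier G" "h' \<in> carrier G"
  shows "tens g (h \<otimes> h') = tens g h \<otimes>\<^bsub>T\<^esub> tens (conj_act G h g) (conj_act G h h')"
proof -
  have "([((g, h \<otimes> h'), True)], [((g, h), True), ((conj_act G h g, conj_act G h h'), True)])
      \<in> tensor_relations G"
    using assms unfolding tensor_relations_def by blast
  from pres_class_relation[OF this, of "carrier G \<times> carrier G"] show ?thesis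
    using assms by (simp add: tensor_square_def tensor_elt_def pres_class_mult)
qed

definition tgens where "tgens = {tens x y |x y. x \<in> carrier G \<and> y \<in> carrier G}"

lemma T_generate: "carrier T = generate T tgens"
proof -
  have "(\<lambda>x. pres_rel (carrier G \<times> carrier G) (tensor_relations G) `` {[(x, True)]})
      ` (carrier G \<times> carrier G) = tgens"
    by (auto simp: tensor_elt_def tgens_def)
  then show ?thesis
    unfolding tensor_square_def using presented_group_generate by metis
qed

definition tlift :: "('h, 'n) monoid_scheme \<Rightarrow> ('a \<Rightarrow> 'a \<Rightarrow> 'h) \<Rightarrow> ('a \<times> 'a) word set \<Rightarrow> 'h" where
  "tlift H F = pres_lift H (\<lambda>(x, y). F x y)"

text \<open>Von Dyck's theorem for \<open>T\<close>: \<open>left\<close> and \<open>right\<close>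
  are the images of the two families in \<open>tensor_relations\<close>.\<close>

lemma tlift:
  assumes "group H"
    and closed: "\<And>x y. x \<in> carrier G \<Longrightarrow> y \<in> carrier G \<Longrightarrow> F x y \<in> carrier H"
    and left: "\<And>g g' h. \<lbrakk>g \<in> carrier G; g' \<in> carrier G; h \<in> carrier G\<rbrakk>
      \<Longrightarrow> F (g \<otimes> g') h = F (conj_act G g g') (conj_act G g h) \<otimes>\<^bsub>H\<^esub> F g h"
    and right: "\<And>g h h'. \<lbrakk>g \<in> carrier G; h \<in> carrier G; h' \<in> carrier G\<rbrakk>
      \<Longrightarrow> F g (h \<otimes> h') = F g h \<otimes>\<^bsub>H\<^esub> F (conj_act G h g) (conj_act G h h')"
  shows tlift_hom: "tlift H F \<in> hom T H"
    and tlift_tens: "\<And>x y. x \<in> carrier G \<Longrightarrow> y \<in> carrier G \<Longrightarrow> tlift H F (tens x y) = F x y"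
proof -
  interpret H: group H by fact
  interpret presentation_map H "carrier G \<times> carrier G" "tensor_relations G" "\<lambda>(x, y). F x y"
  proof
    show "(\<lambda>(x, y). F x y) ` (carrier G \<times> carrier G) \<subseteq> carrier H"
      using closed by auto
  next
    fix u v assume "(u, v) \<in> tensor_relations G"
    then show "word_eval H (\<lambda>(x, y). F x y) u = word_eval H (\<lambda>(x, y). F x y) v"
      unfolding tensor_relations_def by (auto simp: closed left right)
  qed
  show "tlift H F \<in> hom T H"
    unfolding tlift_def tensor_square_def by (rule pres_lift_hom)
  fix x y assume "x \<in> carrier G" "y \<in> carrier G"
  then show "tlift H F (tens x y) = F x y"
    unfolding tlift_def tensor_elt_def by (subst pres_lift_generator) auto
qed

lemma hom_eq_on_T:
  assumes "f \<in> hom T H" "g \<in> hom T H" "group H"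
    and "\<And>x y. x \<in> carrier G \<Longrightarrow> y \<in> carrier G \<Longrightarrow> f (tens x y) = g (tens x y)" "t \<in> carrier T"
  shows "f t = g t"
proof (rule group.hom_eq_on_generate[OF T_group assms(1-3)])
  show "tgens \<subseteq> carrier T" using tens_closed by (auto simp: tgens_def)
  show "t \<in> generate T tgens" using assms(5) T_generate by simp
qed (use assms(4) in \<open>auto simp: tgens_def\<close>)

text \<open>The recursion of \<open>commutator_word\<close> is a word evaluation, so
  \<open>kappa\<close> gets the homomorphism property from \<open>tlift\<close>.\<close>

lemma kappa_eq: "kappa G = tlift G (commutator_elt G)"
proof -
  have "commutator_word G w = word_eval G (\<lambda>(x, y). commutator_elt G x y) w" for w
    by (induction G w rule: commutator_word.induct) simp_all
  then show ?thesis
    unfolding kappa_def tlift_def pres_lift_def by presburger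
qed

lemma kappa_hom: "kappa G \<in> hom T G"
  and kappa_tens: "x \<in> carrier G \<Longrightarrow> y \<in> carrier G \<Longrightarrow> kappa G (tens x y) = commutator_elt G x y"
  unfolding kappa_eq
  by (rule tlift_hom tlift_tens; simp add: commutator_mult_left commutator_mult_right is_group)+

section \<open>The conjugation action on the tensor square\<close>

definition tact :: "'a \<Rightarrow> ('a \<times> 'a) word set \<Rightarrow> ('a \<times> 'a) word set" where
  "tact x = tlift T (\<lambda>g h. tens (conj_act G x g) (conj_act G x h))"

lemma tact_hom: "x \<in> carrier G \<Longrightarrow> tact x \<in> hom T T"
  unfolding tact_def
  by (rule tlift_hom)
    (simp_all add: T_group tens_closed conj_act_mult tens_mult_left tens_mult_right flip: conj_act_conj)

lemma tact_tens: "x \<in> carrier G \<Longrightarrow> g \<in> carrier G \<Longrightarrow> h \<in> carrier G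
    \<Longrightarrow> tact x (tens g h) = tens (conj_act G x g) (conj_act G x h)"
  unfolding tact_def
  by (rule tlift_tens)
    (simp_all add: T_group tens_closed conj_act_mult tens_mult_left tens_mult_right flip: conj_act_conj)

text \<open>The laws of the action are equalities of homomorphisms; by \<open>hom_eq_on_T\<close>
  they reduce to laws of conjugation in \<open>G\<close>.\<close>

lemma T_crossed_pairing: "crossed_pairing G T tact tens"
proof (intro crossed_pairing.intro crossed_pairing_axioms.intro)
  show "group T" by (rule T_group)
  fix x y u assume xy: "x \<in> carrier G" "y \<in> carrier G" "u \<in> carrier T"
  have "tact x \<circ> tact y \<in> hom T T" 
    using xy by (simp_all add: Group.hom_compose[OF tact_hom tact_hom])
  then have "(tact x \<circ> tact y) u = tact (x \<otimes> y) u"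
    by (rule hom_eq_on_T[of _ T])
      (use xy in \<open>simp_all add: T_group tact_hom tact_tens conj_act_conj_act\<close>)
  then show "tact x (tact y u) = tact (x \<otimes> y) u" by simp
next
  fix u assume u: "u \<in> carrier T"
  have "tact \<one> u = id u"
  proof (rule hom_eq_on_T[of "tact \<one>" T id])
    show "tact \<one> \<in> hom T T" by (simp add: tact_hom)
  qed (use u in \<open>simp_all add: T_group tact_tens conj_act_def id_def hom_def Pi_def group.is_group\<close>)
  then show "tact \<one> u = u" by simp
next
  show "carrier T = generate T {tens x y |x y. x \<in> carrier G \<and> y \<in> carrier G}"
    using T_generate by (simp add: tgens_def)
qed (simp_all add: is_group tens_closed tact_hom tact_tens tens_mult_left tens_mult_right)

end

sublocale tensor_group \<subseteq> tp: crossed_pairing G "tensor_square G" tact "tensor_elt G"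
  by (rule T_crossed_pairing)

sublocale tensor_group \<subseteq> kap: group_hom "tensor_square G" G "kappa G"
  by unfold_locales (rule kappa_hom)

context tensor_group
begin

declare tens_closed [simp]

text \<open>\<open>pair_conj_commutator\<close> gives this for generators, and \<open>kappa\<close>
  being a homomorphism carries it to products: \<open>kappa\<close> is a crossed module.\<close>

lemma tact_kappa:
  assumes "t \<in> carrier T" "s \<in> carrier T"
  shows "tact (kappa G t) s \<otimes>\<^bsub>T\<^esub> t = t \<otimes>\<^bsub>T\<^esub> s"
proof -
  have "t \<in> generate T tgens" using assms(1) T_generate by simp
  then show ?thesis using assms(2)
  proof (induction arbitrary: s)
    case one
    then show ?case by (simp add: tp.act_one)
  next
    case (incl t)
    then obtain x y where "t = tens x y" "x \<in> carrier G" "y \<in> carrier G"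
      by (auto simp: tgens_def)
    then show ?case using incl.prems tp.pair_conj_commutator by (simp add: kappa_tens)
  next
    case (inv t)
    then obtain x y where xy: "t = tens x y" "x \<in> carrier G" "y \<in> carrier G"
      by (auto simp: tgens_def)
    let ?k = "commutator_elt G x y"
    \<comment> \<open>The generator case is applied to \<open>tact (inv ?k) s\<close>; multiplying
      by the inverse of \<open>t\<close> on both sides then gives the claim.\<close>
    have "s \<otimes>\<^bsub>T\<^esub> t = t \<otimes>\<^bsub>T\<^esub> tact (inv ?k) s"
      using tp.pair_conj_commutator[OF xy(2,3), of "tact (inv ?k) s"] inv.prems xy by simp
    then have "inv\<^bsub>T\<^esub> t \<otimes>\<^bsub>T\<^esub> (s \<otimes>\<^bsub>T\<^esub> t) \<otimes>\<^bsub>T\<^esub> inv\<^bsub>T\<^esub> t = tact (inv ?k) s \<otimes>\<^bsub>T\<^esub> inv\<^bsub>T\<^esub> t"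
      using inv.prems xy by simp
    then show ?case using inv.prems xy by (simp add: kappa_tens tp.W.m_assoc)
  next
    case (eng t t')
    then have t: "t \<in> carrier T" "t' \<in> carrier T" using T_generate by simp_all
    have "tact (kappa G (t \<otimes>\<^bsub>T\<^esub> t')) s \<otimes>\<^bsub>T\<^esub> (t \<otimes>\<^bsub>T\<^esub> t')
        = (tact (kappa G t) (tact (kappa G t') s) \<otimes>\<^bsub>T\<^esub> t) \<otimes>\<^bsub>T\<^esub> t'"
      using t eng.prems by (simp add: tp.act_act tp.W.m_assoc)
    also have "\<dots> = t \<otimes>\<^bsub>T\<^esub> (tact (kappa G t') s \<otimes>\<^bsub>T\<^esub> t')"
      using t eng.prems eng.IH(1)[of "tact (kappa G t') s"] by (simp add: tp.W.m_assoc)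
    also have "\<dots> = (t \<otimes>\<^bsub>T\<^esub> t') \<otimes>\<^bsub>T\<^esub> s"
      using t eng.prems eng.IH(2) by (simp add: tp.W.m_assoc)
    finally show ?case .
  qed
qed

section \<open>The central subgroups \<open>J\<close> and \<open>nabla G\<close>\<close>

abbreviation J where "J \<equiv> kernel T G (kappa G)"

text \<open>When \<open>kappa\<close> is trivial, the action in \<open>tact_kappa\<close>
  disappears.\<close>

lemma J_central: "t \<in> J \<Longrightarrow> s \<in> carrier T \<Longrightarrow> s \<otimes>\<^bsub>T\<^esub> t = t \<otimes>\<^bsub>T\<^esub> s"
  using tact_kappa[of t s] by (simp add: kernel_def tp.act_one)

lemma diag_in_J: "x \<in> carrier G \<Longrightarrow> tens x x \<in> J"
  by (simp add: kernel_def kappa_tens commutator_elt_def m_assoc)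

lemma nabla_J: "nabla G \<subseteq> J"
  unfolding nabla_def
  by (rule tp.W.generate_subgroup_incl[OF _ kap.subgroup_kernel]) (auto simp: diag_in_J)

lemma J_T: "J \<subseteq> carrier T"
  by (auto simp: kernel_def)

lemma nabla_subgroup: "subgroup (nabla G) T"
  unfolding nabla_def by (rule tp.W.generate_is_subgroup) auto

lemma diag_in_nabla: "x \<in> carrier G \<Longrightarrow> tens x x \<in> nabla G"
  unfolding nabla_def by (auto intro: generate.incl)

lemma nabla_T: "nabla G \<subseteq> carrier T"
  using nabla_J J_T by blast

lemma nabla_central: "n \<in> nabla G \<Longrightarrow> s \<in> carrier T \<Longrightarrow> s \<otimes>\<^bsub>T\<^esub> n = n \<otimes>\<^bsub>T\<^esub> s"
  using nabla_J J_central by blast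

lemma nabla_normal: "nabla G \<lhd> T"
  by (rule tp.W.central_subgroup_normal[OF nabla_subgroup nabla_central])

lemma tact_nabla: "x \<in> carrier G \<Longrightarrow> n \<in> nabla G \<Longrightarrow> tact x n \<in> nabla G"
proof -
  assume x: "x \<in> carrier G" and n: "n \<in> nabla G"
  interpret a: group_hom T T "tact x"
    by unfold_locales (rule tact_hom[OF x])
  have "tact x ` nabla G = generate T (tact x ` {tens x x |x. x \<in> carrier G})"
    unfolding nabla_def by (rule a.generate_img[symmetric]) auto
  also have "\<dots> \<subseteq> nabla G"
    by (rule tp.W.generate_subgroup_incl[OF _ nabla_subgroup])
      (auto simp: tact_tens x diag_in_nabla)
  finally show ?thesis using n by blast
qed

section \<open>The exterior square as an alternating pairing\<close>

definition wed :: "'a \<Rightarrow> 'a \<Rightarrow> ('a \<times> 'a) word set set" where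
  "wed x y = nabla G #>\<^bsub>T\<^esub> tens x y"

text \<open>Each \<open>tact x\<close> preserves \<open>nabla G\<close> and so descends to the
  quotient; the pairing laws are inherited from \<open>T\<close>, and the diagonal has become
  trivial.\<close>

lemma ex_exterior_pairing: "\<exists>wact. alternating_pairing G (exterior_square G) wact wed"
proof -
  let ?W = "exterior_square G" and ?q = "\<lambda>t. nabla G #>\<^bsub>T\<^esub> t"
  have W: "group ?W"
    unfolding exterior_square_def using nabla_normal by (rule normal.factorgroup_is_group)
  have q: "?q \<in> hom T ?W"
    unfolding exterior_square_def using nabla_normal by (rule normal.r_coset_hom_Mod)
  interpret q: group_hom T ?W ?q
    using W q by (simp add: group_hom_def group_hom_axioms_def T_group)
  have carW: "carrier ?W = ?q ` carrier T"
    by (simp add: exterior_square_def carrier_FactGroup)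
  have "\<exists>f. f \<in> hom ?W ?W \<and> (\<forall>t\<in>carrier T. f (?q t) = ?q (tact x t))" if x: "x \<in> carrier G" for x
  proof -
    have "?q \<circ> tact x \<in> hom T ?W" using tact_hom[OF x] q by (rule Group.hom_compose)
    then interpret qa: group_hom T ?W "?q \<circ> tact x"
      using W by (simp add: group_hom_def group_hom_axioms_def T_group)
    have "nabla G \<subseteq> kernel T ?W (?q \<circ> tact x)"
    proof
      fix n assume n: "n \<in> nabla G"
      then have "n \<in> carrier T" using nabla_T by blast
      then have "?q (tact x n) = nabla G"
        using x n by (intro tp.W.coset_join2) (simp_all add: nabla_subgroup tact_nabla)
      with \<open>n \<in> carrier T\<close> show "n \<in> kernel T ?W (?q \<circ> tact x)"
        by (simp add: kernel_def exterior_square_def)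
    qed
    from qa.FactGroup_universal_kernel[OF nabla_normal this] show ?thesis
      unfolding exterior_square_def by (metis comp_apply)
  qed
  \<comment> \<open>One descended map is chosen for each \<open>x\<close>. Its values on cosets
    settle every law, because the cosets exhaust the quotient.\<close>
  then obtain wact where wact: "\<And>x. x \<in> carrier G \<Longrightarrow> wact x \<in> hom ?W ?W"
    "\<And>x t. x \<in> carrier G \<Longrightarrow> t \<in> carrier T \<Longrightarrow> wact x (?q t) = ?q (tact x t)"
    by metis
  have "alternating_pairing G ?W wact wed"
  proof (intro alternating_pairing.intro crossed_pairing.intro crossed_pairing_axioms.intro
      alternating_pairing_axioms.intro)
    fix x y u assume "x \<in> carrier G" "y \<in> carrier G" "u \<in> carrier ?W"
    then show "wact x (wact y u) = wact (x \<otimes> y) u"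
      by (auto simp: carW wact(2) tp.act_act)
  next
    fix u assume "u \<in> carrier ?W"
    then show "wact \<one> u = u" by (auto simp: carW wact(2) tp.act_one)
  next
    have "?q ` tgens = {wed x y |x y. x \<in> carrier G \<and> y \<in> carrier G}"
      by (auto simp: tgens_def wed_def)
    moreover have "tgens \<subseteq> carrier T" by (auto simp: tgens_def)
    ultimately show "carrier ?W = generate ?W {wed x y |x y. x \<in> carrier G \<and> y \<in> carrier G}"
      using q.generate_img[of tgens] by (simp only: carW T_generate)
  next
    fix x assume "x \<in> carrier G"
    then show "wed x x = \<one>\<^bsub>?W\<^esub>"
      unfolding wed_def exterior_square_def
      by (simp add: tp.W.coset_join2 nabla_subgroup diag_in_nabla)
  qed (simp_all add: W is_group wact wed_def tact_tens tens_mult_left tens_mult_right)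
  then show ?thesis by (rule exI[of _ wact])
qed

text \<open>This is \<open>pair_swap\<close> in the exterior square, read back as membership in the
  subgroup factored out.\<close>

lemma tens_swap_nabla:
  assumes "x \<in> carrier G" "y \<in> carrier G"
  shows "tens x y \<otimes>\<^bsub>T\<^esub> tens y x \<in> nabla G"
proof -
  obtain wact where "alternating_pairing G (exterior_square G) wact wed"
    using ex_exterior_pairing ..
  then have "wed x y <#>\<^bsub>T\<^esub> wed y x = nabla G"
    using alternating_pairing.pair_swap[of G "exterior_square G" wact wed x y] assms
    by (simp add: exterior_square_def)
  then have "nabla G #>\<^bsub>T\<^esub> (tens x y \<otimes>\<^bsub>T\<^esub> tens y x) = nabla G"
    using assms by (simp add: wed_def normal.rcos_sum[OF nabla_normal])
  then show ?thesis
    by (rule tp.W.coset_join1) (use assms nabla_subgroup in simp_all)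
qed

end

section \<open>Splitting off the diagonal\<close>

text \<open>As \<open>r\<close> is bijective on \<open>N\<close>, its kernel is a normal complement
  of \<open>N\<close>; the isomorphism is \<open>r\<close> paired with the projection. Asking for a
  bijection on \<open>N\<close> rather than the identity lets squaring play the role of
  \<open>r\<close>.\<close>

lemma DirProd_Mod_iso:
  assumes "group G" "N \<lhd> G" "r \<in> hom G (G\<lparr>carrier := N\<rparr>)" "bij_betw r N N"
  shows "G \<cong> G\<lparr>carrier := N\<rparr> \<times>\<times> (G Mod N)"
proof -
  interpret G: group G by fact
  interpret N: normal N G by fact
  have r: "r x \<in> N" "r (x \<otimes>\<^bsub>G\<^esub> y) = r x \<otimes>\<^bsub>G\<^esub> r y" if "x \<in> carrier G" "y \<in> carrier G" for x y
    using assms(3) that by (auto simp: hom_def)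
  have NG: "n \<in> carrier G" if "n \<in> N" for n using that by (rule N.mem_carrier)
  let ?h = "\<lambda>x. (r x, N #>\<^bsub>G\<^esub> x)"
  have "?h \<in> iso G (G\<lparr>carrier := N\<rparr> \<times>\<times> (G Mod N))"
  proof (rule isoI)
    show "?h \<in> hom G (G\<lparr>carrier := N\<rparr> \<times>\<times> (G Mod N))"
      using assms(3) N.r_coset_hom_Mod by (simp add: hom_paired)
    show "bij_betw ?h (carrier G) (carrier (G\<lparr>carrier := N\<rparr> \<times>\<times> (G Mod N)))"
    proof (rule bij_betw_imageI)
      show "inj_on ?h (carrier G)"
      proof (rule inj_onI)
        fix x y assume xy: "x \<in> carrier G" "y \<in> carrier G" and eq: "?h x = ?h y"
        then have "N #>\<^bsub>G\<^esub> x = N #>\<^bsub>G\<^esub> y" "x \<in> N #>\<^bsub>G\<^esub> x"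
          using G.rcos_self N.subgroup_axioms by auto
        then obtain n where n: "n \<in> N" "x = n \<otimes>\<^bsub>G\<^esub> y"
          by (auto simp: r_coset_def)
        with xy eq r[of n y] NG[OF n(1)] r(1)[of y y] have "r n \<otimes>\<^bsub>G\<^esub> r y = \<one>\<^bsub>G\<^esub> \<otimes>\<^bsub>G\<^esub> r y"
          using NG by simp
        then have "r n = \<one>\<^bsub>G\<^esub>"
          using xy n NG r(1) G.right_cancel by (metis G.one_closed)
        moreover have "r \<one>\<^bsub>G\<^esub> = \<one>\<^bsub>G\<^esub>"
          using r[of "\<one>\<^bsub>G\<^esub>" "\<one>\<^bsub>G\<^esub>"] NG by (metis G.l_cancel_one' G.one_closed G.r_one)
        ultimately have "n = \<one>\<^bsub>G\<^esub>"
          using assms(4) n N.one_closed by (metis bij_betw_imp_inj_on inj_on_eq_iff)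
        then show "x = y" using n xy by simp
      qed
      show "?h ` carrier G = carrier (G\<lparr>carrier := N\<rparr> \<times>\<times> (G Mod N))"
      proof
        show "?h ` carrier G \<subseteq> carrier (G\<lparr>carrier := N\<rparr> \<times>\<times> (G Mod N))"
          using r by (auto simp: carrier_FactGroup)
        show "carrier (G\<lparr>carrier := N\<rparr> \<times>\<times> (G Mod N)) \<subseteq> ?h ` carrier G"
        proof
          fix z assume "z \<in> carrier (G\<lparr>carrier := N\<rparr> \<times>\<times> (G Mod N))"
          then obtain m y where z: "z = (m, N #>\<^bsub>G\<^esub> y)" "m \<in> N" "y \<in> carrier G"
            by (auto simp: carrier_FactGroup)
          \<comment> \<open>The representative \<open>y\<close> is corrected by the element of
            \<open>N\<close> whose image makes up the difference between \<open>r y\<close> and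
            \<open>m\<close>; this does not change its coset.\<close>
          then have "m \<otimes>\<^bsub>G\<^esub> inv\<^bsub>G\<^esub> (r y) \<in> r ` N"
            using r assms(4) by (simp add: bij_betw_imp_surj_on)
          then obtain n where n: "n \<in> N" "r n = m \<otimes>\<^bsub>G\<^esub> inv\<^bsub>G\<^esub> (r y)"
            by (metis imageE)
          have "r (n \<otimes>\<^bsub>G\<^esub> y) = m"
            using n z r[of n y] r(1)[of y y] NG by (simp add: G.m_assoc)
          moreover have "N #>\<^bsub>G\<^esub> (n \<otimes>\<^bsub>G\<^esub> y) = N #>\<^bsub>G\<^esub> y"
            using n z NG N.subset by (simp add: N.rcos_const flip: G.coset_mult_assoc)
          moreover have "n \<otimes>\<^bsub>G\<^esub> y \<in> carrier G" using n z NG by simp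
          ultimately show "z \<in> ?h ` carrier G"
            unfolding z(1) by (intro image_eqI[of _ _ "n \<otimes>\<^bsub>G\<^esub> y"]) simp_all
        qed
      qed
    qed
  qed
  then show ?thesis by (rule is_isoI)
qed

lemma (in group) subgroup_nat_pow_closed:
  "subgroup H G \<Longrightarrow> x \<in> H \<Longrightarrow> x [^] (n::nat) \<in> H"
  by (induction n) (auto intro: subgroup.one_closed subgroup.m_closed)

text \<open>Were the order \<open>2 * k\<close>, the power \<open>x [^] k\<close> would have order
  2.\<close>

lemma (in group) odd_ord:
  assumes "x \<in> carrier G" "\<exists>n::nat. n > 0 \<and> x [^] n = \<one>" "\<not> (\<exists>y\<in>carrier G. ord y = 2)"
  shows "odd (ord x)"
proof
  assume "even (ord x)"
  then obtain k where k: "ord x = 2 * k" by (rule evenE)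
  \<comment> \<open>An order of 0 stands for infinite order, which torsion excludes; so
    \<open>k\<close> is positive and smaller than \<open>ord x\<close>.\<close>
  have "ord x \<noteq> 0" using assms(1,2) pow_eq_id by (metis dvd_0_left_iff less_irrefl)
  then have "k > 0" "k < ord x" using k by simp_all
  then have ne: "x [^] k \<noteq> \<one>" using assms(1) pow_eq_id nat_dvd_not_less by metis
  have "(x [^] k) [^] (2::nat) = \<one>"
    using assms(1) k by (metis mult.commute nat_pow_pow pow_ord_eq_1)
  then have "ord (x [^] k) dvd 2" using assms(1) pow_eq_id by simp
  moreover have "ord (x [^] k) \<noteq> 1" using ne assms(1) ord_eq_1 by simp
  moreover from calculation have "ord (x [^] k) \<le> 2" "ord (x [^] k) \<noteq> 0"
    by (auto intro: dvd_imp_le gr0I)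
  ultimately have "ord (x [^] k) = 2" by linarith
  then show False using assms(1,3) by blast
qed

section \<open>Odd torsion and square roots in \<open>nabla G\<close>\<close>

locale odd_torsion_group = tensor_group +
  assumes torsion: "\<And>x. x \<in> carrier G \<Longrightarrow> \<exists>n::nat. n > 0 \<and> x [^] n = \<one>"
    and no_involution: "\<not> (\<exists>x\<in>carrier G. ord x = 2)"
begin

lemma diag_pow_ord: "x \<in> carrier G \<Longrightarrow> tens x x [^]\<^bsub>T\<^esub> (ord x) = \<one>\<^bsub>T\<^esub>"
  by (simp flip: tp.pair_pow)

lemma ord_odd: "x \<in> carrier G \<Longrightarrow> odd (ord x)"
  by (rule odd_ord[OF _ torsion no_involution])

text \<open>The order of \<open>x\<close> is an odd exponent for the generator
  \<open>tens x x\<close>; elements of \<open>nabla G\<close> commute, so exponents of factors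
  multiply and stay odd.\<close>

lemma nabla_odd_torsion:
  assumes "n \<in> nabla G"
  shows "\<exists>k::nat. odd k \<and> n [^]\<^bsub>T\<^esub> k = \<one>\<^bsub>T\<^esub>"
  using assms[unfolded nabla_def]
proof induction
  case one
  then show ?case by (intro exI[of _ 1]) simp
next
  case (incl n)
  then obtain x where "x \<in> carrier G" "n = tens x x" by blast
  then show ?case
    using ord_odd diag_pow_ord by (intro exI[of _ "ord x"]) simp
next
  case (inv n)
  then obtain x where "x \<in> carrier G" "n = tens x x" by blast
  then show ?case
    using ord_odd diag_pow_ord
    by (intro exI[of _ "ord x"]) (simp add: tp.W.nat_pow_inv)
next
  case (eng m n)
  then obtain k l :: nat where kl: "odd k" "m [^]\<^bsub>T\<^esub> k = \<one>\<^bsub>T\<^esub>" "odd l" "n [^]\<^bsub>T\<^esub> l = \<one>\<^bsub>T\<^esub>"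
    by blast
  have mn: "m \<in> nabla G" "n \<in> nabla G" using eng.hyps by (simp_all add: nabla_def)
  then have c: "m \<in> carrier T" "n \<in> carrier T" using nabla_T by blast+
  have "m [^]\<^bsub>T\<^esub> (k * l) = \<one>\<^bsub>T\<^esub>" "n [^]\<^bsub>T\<^esub> (l * k) = \<one>\<^bsub>T\<^esub>"
    using c kl by (simp_all flip: tp.W.nat_pow_pow)
  then have "(m \<otimes>\<^bsub>T\<^esub> n) [^]\<^bsub>T\<^esub> (k * l) = \<one>\<^bsub>T\<^esub>"
    using c nabla_central[OF mn(2) c(1)] by (simp add: tp.W.pow_mult_distrib mult.commute[of l])
  then show ?case using kl by (intro exI[of _ "k * l"]) simp
qed

lemma nabla_sqrt:
  assumes "n \<in> nabla G"
  obtains j :: nat where "(n \<otimes>\<^bsub>T\<^esub> n) [^]\<^bsub>T\<^esub> j = n"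
proof -
  have c: "n \<in> carrier T" using assms nabla_T by blast
  obtain k :: nat where k: "odd k" "n [^]\<^bsub>T\<^esub> k = \<one>\<^bsub>T\<^esub>"
    using nabla_odd_torsion[OF assms] by blast
  \<comment> \<open>For odd \<open>k\<close> half of \<open>k + 1\<close> is an integer, and the
    power \<open>k + 1\<close> of \<open>n\<close> is \<open>n\<close> itself.\<close>
  then obtain j where j: "k + 1 = 2 * j" by (metis even_add evenE odd_one)
  have "(n \<otimes>\<^bsub>T\<^esub> n) [^]\<^bsub>T\<^esub> j = (n [^]\<^bsub>T\<^esub> (2::nat)) [^]\<^bsub>T\<^esub> j"
    using c by (simp add: numeral_2_eq_2)
  also have "\<dots> = n [^]\<^bsub>T\<^esub> (k + 1)"
    using c j by (simp only: tp.W.nat_pow_pow)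
  also have "\<dots> = n"
    using c k by simp
  finally show ?thesis by (rule that)
qed

section \<open>The swap and the splittings derived from it\<close>

definition tswap where
  "tswap = tlift T (\<lambda>g h. inv\<^bsub>T\<^esub> (tens h g))"

text \<open>Taking inverses reverses products, which interchanges the two tensor relations; so the
  formula respects them.\<close>

lemma tswap_hom: "tswap \<in> hom T T"
  and tswap_tens: "x \<in> carrier G \<Longrightarrow> y \<in> carrier G \<Longrightarrow> tswap (tens x y) = inv\<^bsub>T\<^esub> (tens y x)"
  unfolding tswap_def
  by (rule tlift_hom tlift_tens;
      simp add: T_group tens_mult_left tens_mult_right tp.W.inv_mult_group)+

definition tdiag where "tdiag t = t \<otimes>\<^bsub>T\<^esub> inv\<^bsub>T\<^esub> (tswap t)"

lemma tswap_closed [simp]: "t \<in> carrier T \<Longrightarrow> tswap t \<in> carrier T"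
  using tswap_hom by (auto simp: hom_def)

lemma kappa_tswap: "t \<in> carrier T \<Longrightarrow> kappa G (tswap t) = kappa G t"
proof -
  assume t: "t \<in> carrier T"
  have "(kappa G \<circ> tswap) t = kappa G t"
  proof (rule hom_eq_on_T[OF _ kappa_hom is_group _ t])
    show "kappa G \<circ> tswap \<in> hom T G"
      by (rule Group.hom_compose[OF tswap_hom kappa_hom])
  qed (simp add: tswap_tens kappa_tens commutator_elt_def inv_mult_group m_assoc)
  then show ?thesis by simp
qed

lemma tdiag_tens: "x \<in> carrier G \<Longrightarrow> y \<in> carrier G
    \<Longrightarrow> tdiag (tens x y) = tens x y \<otimes>\<^bsub>T\<^esub> tens y x"
  by (simp add: tdiag_def tswap_tens)

text \<open>\<open>tdiag\<close> is multiplicative because its values lie in the central subgroup \<open>J\<close>.\<close>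

lemma tdiag_hom: "tdiag \<in> hom T T"
proof (rule homI)
  fix s t assume st: "s \<in> carrier T" "t \<in> carrier T"
  have "tdiag t \<in> J"
    using st by (simp add: kernel_def tdiag_def kappa_tswap)
  then have "tdiag t \<otimes>\<^bsub>T\<^esub> inv\<^bsub>T\<^esub> (tswap s) = inv\<^bsub>T\<^esub> (tswap s) \<otimes>\<^bsub>T\<^esub> tdiag t"
    using J_central st by simp
  then have "s \<otimes>\<^bsub>T\<^esub> (tdiag t \<otimes>\<^bsub>T\<^esub> inv\<^bsub>T\<^esub> (tswap s))
      = s \<otimes>\<^bsub>T\<^esub> (inv\<^bsub>T\<^esub> (tswap s) \<otimes>\<^bsub>T\<^esub> tdiag t)"
    by simp
  then show "tdiag (s \<otimes>\<^bsub>T\<^esub> t) = tdiag s \<otimes>\<^bsub>T\<^esub> tdiag t"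
    using st hom_mult[OF tswap_hom st]
    by (simp add: tdiag_def tp.W.inv_mult_group tp.W.m_assoc)
qed (simp add: tdiag_def)

text \<open>The generators are sent to the products treated in
  \<open>tens_swap_nabla\<close>.\<close>

lemma tdiag_nabla: "t \<in> carrier T \<Longrightarrow> tdiag t \<in> nabla G"
proof -
  assume t: "t \<in> carrier T"
  interpret d: group_hom T T tdiag
    by unfold_locales (rule tdiag_hom)
  have "tdiag ` generate T tgens = generate T (tdiag ` tgens)"
    by (rule d.generate_img[symmetric]) (auto simp: tgens_def)
  also have "\<dots> \<subseteq> nabla G"
    by (rule tp.W.generate_subgroup_incl[OF _ nabla_subgroup])
      (auto simp: tgens_def tdiag_tens tens_swap_nabla)
  finally show ?thesis using t T_generate by auto
qed

text \<open>The swap inverts every \<open>tens x x\<close>, and squaring is multiplicative on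
  \<open>nabla G\<close> because that subgroup is central.\<close>

lemma tdiag_on_nabla:
  assumes "n \<in> nabla G"
  shows "tdiag n = n \<otimes>\<^bsub>T\<^esub> n"
  using assms[unfolded nabla_def]
proof induction
  case one
  then show ?case using hom_one[OF tswap_hom T_group T_group] by (simp add: tdiag_def)
next
  case (incl n)
  then show ?case by (auto simp: tdiag_tens)
next
  case (inv n)
  then obtain x where x: "x \<in> carrier G" "n = tens x x" by blast
  interpret d: group_hom T T tdiag
    by unfold_locales (rule tdiag_hom)
  show ?case using x by (simp add: tdiag_tens tp.W.inv_mult_group)
next
  case (eng m n)
  have mn: "m \<in> nabla G" "n \<in> nabla G" using eng.hyps by (simp_all add: nabla_def)
  then have c: "m \<in> carrier T" "n \<in> carrier T" using nabla_T by blast+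
  have "m \<otimes>\<^bsub>T\<^esub> (m \<otimes>\<^bsub>T\<^esub> n) \<otimes>\<^bsub>T\<^esub> n = m \<otimes>\<^bsub>T\<^esub> (n \<otimes>\<^bsub>T\<^esub> m) \<otimes>\<^bsub>T\<^esub> n"
    using nabla_central[OF mn(2) c(1)] by simp
  then show ?case
    using eng.IH c hom_mult[OF tdiag_hom c] by (simp add: tp.W.m_assoc)
qed

text \<open>On \<open>nabla G\<close> the map is squaring, and \<open>nabla_sqrt\<close> writes each
  element as a power of its square. Hence squares are trivial only for the identity, and the same
  power of \<open>n\<close> is a preimage of \<open>n\<close>.\<close>

lemma tdiag_bij: "bij_betw tdiag (nabla G) (nabla G)"
proof (rule bij_betw_imageI)
  show "inj_on tdiag (nabla G)"
  proof (rule inj_onI)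
    fix m n assume mn: "m \<in> nabla G" "n \<in> nabla G" "tdiag m = tdiag n"
    have c: "m \<in> carrier T" "n \<in> carrier T" using mn nabla_T by blast+
    let ?d = "m \<otimes>\<^bsub>T\<^esub> inv\<^bsub>T\<^esub> n"
    interpret d: group_hom T T tdiag
      by unfold_locales (rule tdiag_hom)
    have "?d \<in> nabla G"
      using mn nabla_subgroup by (simp add: subgroup.m_closed subgroup.m_inv_closed)
    moreover from this have "?d \<otimes>\<^bsub>T\<^esub> ?d = \<one>\<^bsub>T\<^esub>"
      using c mn(3) by (simp flip: tdiag_on_nabla)
    ultimately have "?d = \<one>\<^bsub>T\<^esub>"
      using nabla_sqrt by (metis tp.W.nat_pow_one)
    then show "m = n" using c by (metis tp.W.inv_equality tp.W.inv_inv tp.W.inv_closed)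
  qed
  have "n \<in> tdiag ` nabla G" if n: "n \<in> nabla G" for n
  proof -
    have c: "n \<in> carrier T" using n nabla_T by blast
    obtain j :: nat where j: "(n \<otimes>\<^bsub>T\<^esub> n) [^]\<^bsub>T\<^esub> j = n" using n by (rule nabla_sqrt)
    have "tdiag (n [^]\<^bsub>T\<^esub> j) = tdiag n [^]\<^bsub>T\<^esub> j"
      using Group.hom_nat_pow[OF tdiag_hom c T_group T_group] .
    also have "\<dots> = n" using n j by (simp add: tdiag_on_nabla)
    finally show ?thesis
      using n nabla_subgroup c by (metis image_eqI tp.W.subgroup_nat_pow_closed)
  qed
  then show "tdiag ` nabla G = nabla G"
    using tdiag_nabla nabla_T by blast
qed

lemma tensor_square_split: "tensor_square G \<cong> nabla_group G \<times>\<times> exterior_square G"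
  unfolding nabla_group_def exterior_square_def
proof (rule DirProd_Mod_iso[OF T_group nabla_normal _ tdiag_bij])
  show "tdiag \<in> hom T (T\<lparr>carrier := nabla G\<rparr>)"
    using tdiag_hom tdiag_nabla by (auto simp: hom_def)
qed

lemma J_group_group: "group (J_group G)"
  unfolding J_group_def by (rule tp.W.subgroup_imp_group[OF kap.subgroup_kernel])

lemma nabla_normal_J: "nabla G \<lhd> J_group G"
proof (rule group.central_subgroup_normal[OF J_group_group])
  show "subgroup (nabla G) (J_group G)"
    unfolding J_group_def
    by (rule tp.W.subgroup_incl[OF nabla_subgroup kap.subgroup_kernel nabla_J])
qed (use J_T nabla_central in \<open>auto simp: J_group_def\<close>)

text \<open>The same \<open>tdiag\<close> works on the smaller group, which still contains
  \<open>nabla G\<close>.\<close>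

lemma J_group_split: "J_group G \<cong> nabla_group G \<times>\<times> (J_group G Mod nabla G)"
proof -
  have "J_group G \<cong> (J_group G)\<lparr>carrier := nabla G\<rparr> \<times>\<times> (J_group G Mod nabla G)"
  proof (rule DirProd_Mod_iso[OF J_group_group nabla_normal_J _ tdiag_bij])
    show "tdiag \<in> hom (J_group G) ((J_group G)\<lparr>carrier := nabla G\<rparr>)"
      using J_T tdiag_nabla hom_mult[OF tdiag_hom]
      by (intro homI) (simp_all add: J_group_def subset_iff)
  qed
  then show ?thesis by (simp add: nabla_group_def J_group_def)
qed

text \<open>For \<open>x = y\<close> the generators of \<open>Delta G\<close> are the squares of
  \<open>tens x x\<close>, and odd torsion recovers \<open>tens x x\<close> as a power of its
  square.\<close>

lemma Delta_eq_nabla: "Delta G = nabla G"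
proof
  let ?D = "{tens x y \<otimes>\<^bsub>T\<^esub> tens y x |x y. x \<in> carrier G \<and> y \<in> carrier G}"
  show "Delta G \<subseteq> nabla G"
    unfolding Delta_def
    by (rule tp.W.generate_subgroup_incl[OF _ nabla_subgroup]) (auto simp: tens_swap_nabla)
  have D: "subgroup (Delta G) T"
    unfolding Delta_def by (rule tp.W.generate_is_subgroup) auto
  have "tens x x \<in> Delta G" if x: "x \<in> carrier G" for x
  proof -
    have "tens x x \<otimes>\<^bsub>T\<^esub> tens x x \<in> Delta G"
      unfolding Delta_def by (rule generate.incl) (use x in blast)
    then show ?thesis
      using nabla_sqrt[OF diag_in_nabla[OF x]] D by (metis tp.W.subgroup_nat_pow_closed)
  qed
  then show "nabla G \<subseteq> Delta G"
    unfolding nabla_def[of G] by (intro tp.W.generate_subgroup_incl[OF _ D]) auto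
qed

end

section \<open>Central extensions from cocycles\<close>

lemma hom_free_Abelian_group_eq:
  assumes "h \<in> hom (free_Abelian_group S) H" "k \<in> hom (free_Abelian_group S) H" "group H"
    and gens: "\<And>x. x \<in> S \<Longrightarrow> h (frag_of x) = k (frag_of x)" and "Poly_Mapping.keys c \<subseteq> S"
  shows "h c = k c"
  using assms(5)
proof (induction rule: free_Abelian_group_induct[consumes 1, case_names zero diff of])
  case zero
  then show ?case
    using hom_one[OF assms(1) _ assms(3)] hom_one[OF assms(2) _ assms(3)] by simp
next
  case (diff x y)
  have g_diff: "g (x - y) = g x \<otimes>\<^bsub>H\<^esub> inv\<^bsub>H\<^esub> (g y)" if "g \<in> hom (free_Abelian_group S) H" for g
  proof -
    interpret g: group_hom "free_Abelian_group S" H g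
      using that assms(3) by (simp add: group_hom_def group_hom_axioms_def)
    have xy: "x \<in> carrier (free_Abelian_group S)" "y \<in> carrier (free_Abelian_group S)"
      using diff by simp_all
    have "g (x - y) = g (x \<otimes>\<^bsub>free_Abelian_group S\<^esub> inv\<^bsub>free_Abelian_group S\<^esub> y)"
      using diff by simp
    also have "\<dots> = g x \<otimes>\<^bsub>H\<^esub> inv\<^bsub>H\<^esub> (g y)"
      using xy by (simp del: mult_free_Abelian_group inv_free_Abelian_group carrier_free_Abelian_group_iff)
    finally show ?thesis .
  qed
  show ?case using diff by (simp add: g_diff[OF assms(1)] g_diff[OF assms(2)])
qed (rule gens)

text \<open>The central factor is carried through the product until it meets its inverse.\<close>

lemma (in group) commutator_central_left:
  assumes "z \<in> carrier G" "x \<in> carrier G" "y \<in> carrier G"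
    and "\<And>u. u \<in> carrier G \<Longrightarrow> u \<otimes> z = z \<otimes> u"
  shows "commutator_elt G (z \<otimes> x) y = commutator_elt G x y"
proof -
  have "commutator_elt G (z \<otimes> x) y = z \<otimes> (x \<otimes> (y \<otimes> inv x)) \<otimes> inv z \<otimes> inv y"
    using assms(1-3) by (simp add: commutator_elt_def inv_mult_group m_assoc)
  also have "z \<otimes> (x \<otimes> (y \<otimes> inv x)) = (x \<otimes> (y \<otimes> inv x)) \<otimes> z"
    using assms by simp
  finally show ?thesis
    using assms(1-3) by (simp add: commutator_elt_def m_assoc)
qed

lemma (in group) commutator_central_right:
  assumes "z \<in> carrier G" "x \<in> carrier G" "y \<in> carrier G"
    and "\<And>u. u \<in> carrier G \<Longrightarrow> u \<otimes> z = z \<otimes> u"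
  shows "commutator_elt G x (z \<otimes> y) = commutator_elt G x y"
proof -
  have "commutator_elt G x (z \<otimes> y) = x \<otimes> (z \<otimes> y \<otimes> inv x \<otimes> inv y) \<otimes> inv z"
    using assms(1-3) by (simp add: commutator_elt_def inv_mult_group m_assoc)
  also have "\<dots> = x \<otimes> (z \<otimes> (y \<otimes> inv x \<otimes> inv y)) \<otimes> inv z"
    using assms(1-3) by (simp add: m_assoc)
  also have "z \<otimes> (y \<otimes> inv x \<otimes> inv y) = (y \<otimes> inv x \<otimes> inv y) \<otimes> z"
    using assms by simp
  finally show ?thesis
    using assms(1-3) by (simp add: commutator_elt_def m_assoc)
qed

text \<open>A 2-cocycle for the trivial action, written multiplicatively: the identity says that the
  extension of \<open>f\<close> to 2-chains kills the boundary \<open>bar_d3\<close> of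
  \<open>[g|h|k]\<close>.\<close>

locale cocycle_extension = G: group G + B: comm_group B
  for G (structure) and B :: "('b, 'n) monoid_scheme" +
  fixes f :: "'a \<Rightarrow> 'a \<Rightarrow> 'b"
  assumes f_closed [simp]: "g \<in> carrier G \<Longrightarrow> h \<in> carrier G \<Longrightarrow> f g h \<in> carrier B"
    and cocycle: "g \<in> carrier G \<Longrightarrow> h \<in> carrier G \<Longrightarrow> k \<in> carrier G
      \<Longrightarrow> f h k \<otimes>\<^bsub>B\<^esub> f g (h \<otimes> k) = f (g \<otimes> h) k \<otimes>\<^bsub>B\<^esub> f g h"
begin

text \<open>The cocycle identity at \<open>(\<one>, \<one>, k)\<close>, after cancellation.\<close>

lemma f_one_left: "k \<in> carrier G \<Longrightarrow> f \<one> k = f \<one> \<one>"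
  using cocycle[of \<one> \<one> k] by simp

lemma f_one_right: "g \<in> carrier G \<Longrightarrow> f g \<one> = f \<one> \<one>"
  using cocycle[of g \<one> \<one>] by simp

text \<open>The cocycle is not normalised, so the identity has a nontrivial first component.\<close>

definition cext :: "('b \<times> 'a) monoid" where
  "cext = \<lparr>carrier = carrier B \<times> carrier G,
     mult = (\<lambda>(b, g) (c, h). (b \<otimes>\<^bsub>B\<^esub> c \<otimes>\<^bsub>B\<^esub> f g h, g \<otimes> h)),
     one = (inv\<^bsub>B\<^esub> (f \<one> \<one>), \<one>)\<rparr>"

lemma cext_simps [simp]:
  "(b, g) \<in> carrier cext \<longleftrightarrow> b \<in> carrier B \<and> g \<in> carrier G"
  "(b, g) \<otimes>\<^bsub>cext\<^esub> (c, h) = (b \<otimes>\<^bsub>B\<^esub> c \<otimes>\<^bsub>B\<^esub> f g h, g \<otimes> h)"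
  by (simp_all add: cext_def)

lemma cext_one: "\<one>\<^bsub>cext\<^esub> = (inv\<^bsub>B\<^esub> (f \<one> \<one>), \<one>)"
  by (simp add: cext_def)

lemma cext_group: "group cext"
proof (rule groupI)
  fix x y z assume "x \<in> carrier cext" "y \<in> carrier cext" "z \<in> carrier cext"
  then obtain b g c h d k where x: "x = (b, g)" "b \<in> carrier B" "g \<in> carrier G"
    and y: "y = (c, h)" "c \<in> carrier B" "h \<in> carrier G"
    and z: "z = (d, k)" "d \<in> carrier B" "k \<in> carrier G"
    by (cases x; cases y; cases z) auto
  have "b \<otimes>\<^bsub>B\<^esub> c \<otimes>\<^bsub>B\<^esub> f g h \<otimes>\<^bsub>B\<^esub> d \<otimes>\<^bsub>B\<^esub> f (g \<otimes> h) k
      = b \<otimes>\<^bsub>B\<^esub> c \<otimes>\<^bsub>B\<^esub> d \<otimes>\<^bsub>B\<^esub> (f (g \<otimes> h) k \<otimes>\<^bsub>B\<^esub> f g h)"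
    using x y z by (simp add: B.m_ac)
  also have "f (g \<otimes> h) k \<otimes>\<^bsub>B\<^esub> f g h = f h k \<otimes>\<^bsub>B\<^esub> f g (h \<otimes> k)"
    using x y z by (simp add: cocycle)
  also have "b \<otimes>\<^bsub>B\<^esub> c \<otimes>\<^bsub>B\<^esub> d \<otimes>\<^bsub>B\<^esub> \<dots> = b \<otimes>\<^bsub>B\<^esub> (c \<otimes>\<^bsub>B\<^esub> d \<otimes>\<^bsub>B\<^esub> f h k) \<otimes>\<^bsub>B\<^esub> f g (h \<otimes> k)"
    using x y z by (simp add: B.m_ac)
  finally show "x \<otimes>\<^bsub>cext\<^esub> y \<otimes>\<^bsub>cext\<^esub> z = x \<otimes>\<^bsub>cext\<^esub> (y \<otimes>\<^bsub>cext\<^esub> z)"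
    using x y z by (simp add: G.m_assoc)
next
  fix x y assume "x \<in> carrier cext" "y \<in> carrier cext"
  then show "x \<otimes>\<^bsub>cext\<^esub> y \<in> carrier cext"
    by (cases x; cases y) simp
next
  show "\<one>\<^bsub>cext\<^esub> \<in> carrier cext" by (simp add: cext_one)
next
  fix x assume "x \<in> carrier cext"
  then obtain b g where x: "x = (b, g)" "b \<in> carrier B" "g \<in> carrier G" by (cases x) auto
  have "inv\<^bsub>B\<^esub> (f \<one> \<one>) \<otimes>\<^bsub>B\<^esub> b \<otimes>\<^bsub>B\<^esub> f \<one> \<one> = b"
    using x by (simp add: B.m_ac)
  then show "\<one>\<^bsub>cext\<^esub> \<otimes>\<^bsub>cext\<^esub> x = x"
    using x by (simp add: cext_one f_one_left[of g])
next
  fix x assume "x \<in> carrier cext"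
  then obtain b g where x: "x = (b, g)" "b \<in> carrier B" "g \<in> carrier G" by (cases x) auto
  \<comment> \<open>The first component is solved from the product with \<open>x\<close>: it gains
    \<open>f (inv g) g\<close> and must become the inverse of \<open>f \<one> \<one>\<close>, as in
    the identity.\<close>
  let ?y = "(inv\<^bsub>B\<^esub> b \<otimes>\<^bsub>B\<^esub> (inv\<^bsub>B\<^esub> (f (inv g) g) \<otimes>\<^bsub>B\<^esub> inv\<^bsub>B\<^esub> (f \<one> \<one>)), inv g)"
  have "f (inv g) g \<otimes>\<^bsub>B\<^esub> (inv\<^bsub>B\<^esub> (f \<one> \<one>) \<otimes>\<^bsub>B\<^esub> inv\<^bsub>B\<^esub> (f (inv g) g)) = inv\<^bsub>B\<^esub> (f \<one> \<one>)"
    using x by (simp add: B.m_comm[of "inv\<^bsub>B\<^esub> (f \<one> \<one>)"])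
  then have "?y \<otimes>\<^bsub>cext\<^esub> x = \<one>\<^bsub>cext\<^esub>"
    using x by (simp add: cext_one B.m_ac)
  moreover have "?y \<in> carrier cext" using x by simp
  ultimately show "\<exists>y\<in>carrier cext. y \<otimes>\<^bsub>cext\<^esub> x = \<one>\<^bsub>cext\<^esub>" by blast
qed

sublocale E: group cext
  by (rule cext_group)

section \<open>The section, the central inclusion and commutators of lifts\<close>

definition esec :: "'a \<Rightarrow> 'b \<times> 'a" where
  "esec g = (\<one>\<^bsub>B\<^esub>, g)"

text \<open>The shift by the inverse of \<open>f \<one> \<one>\<close> makes this a homomorphism,
  since a product of two elements over \<open>\<one>\<close> picks up one factor
  \<open>f \<one> \<one>\<close>.\<close>

definition einc :: "'b \<Rightarrow> 'b \<times> 'a" where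
  "einc b = (b \<otimes>\<^bsub>B\<^esub> inv\<^bsub>B\<^esub> (f \<one> \<one>), \<one>)"

lemma esec_closed [simp]: "g \<in> carrier G \<Longrightarrow> esec g \<in> carrier cext"
  by (simp add: esec_def)

lemma einc_closed [simp]: "b \<in> carrier B \<Longrightarrow> einc b \<in> carrier cext"
  by (simp add: einc_def)

lemma snd_hom: "snd \<in> hom cext G"
  by (auto simp: hom_def)

lemma einc_hom: "einc \<in> hom B cext"
  by (rule homI) (simp_all add: einc_def B.m_ac)

lemma einc_central:
  assumes "b \<in> carrier B" "u \<in> carrier cext"
  shows "u \<otimes>\<^bsub>cext\<^esub> einc b = einc b \<otimes>\<^bsub>cext\<^esub> u"
proof -
  obtain c g where "u = (c, g)" "c \<in> carrier B" "g \<in> carrier G"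
    using assms(2) by (cases u) auto
  then show ?thesis
    using assms(1) by (simp add: einc_def f_one_left[of g] f_one_right[of g] B.m_ac)
qed

lemma cext_decompose: "b \<in> carrier B \<Longrightarrow> g \<in> carrier G \<Longrightarrow> (b, g) = einc b \<otimes>\<^bsub>cext\<^esub> esec g"
  by (simp add: einc_def esec_def f_one_left[of g] B.m_assoc)

lemma esec_mult: "g \<in> carrier G \<Longrightarrow> h \<in> carrier G
    \<Longrightarrow> einc (f g h) \<otimes>\<^bsub>cext\<^esub> esec (g \<otimes> h) = esec g \<otimes>\<^bsub>cext\<^esub> esec h"
  by (simp add: einc_def esec_def f_one_left[of "g \<otimes> h"] B.m_assoc)

text \<open>Two lifts of the same element of \<open>G\<close> differ by a central factor, which
  commutators do not see.\<close>

lemma commutator_cext: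
  assumes "x \<in> carrier cext" "y \<in> carrier cext"
  shows "commutator_elt cext x y = commutator_elt cext (esec (snd x)) (esec (snd y))"
proof -
  obtain b g c h where x: "x = (b, g)" "b \<in> carrier B" "g \<in> carrier G"
    and y: "y = (c, h)" "c \<in> carrier B" "h \<in> carrier G"
    using assms by (cases x; cases y) auto
  have "commutator_elt cext (einc b \<otimes>\<^bsub>cext\<^esub> esec g) (einc c \<otimes>\<^bsub>cext\<^esub> esec h)
      = commutator_elt cext (esec g) (esec h)"
    using x y by (simp only: E.commutator_central_left E.commutator_central_right einc_central
      einc_closed esec_closed E.m_closed)
  then show ?thesis
    using x y by (simp flip: cext_decompose)
qed

definition ecomm :: "'a \<Rightarrow> 'a \<Rightarrow> 'b \<times> 'a" where
  "ecomm g h = commutator_elt cext (esec g) (esec h)"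

lemma snd_inv: "x \<in> carrier cext \<Longrightarrow> snd (inv\<^bsub>cext\<^esub> x) = inv (snd x)"
  using group_hom.hom_inv[of cext G snd x] snd_hom
  by (simp add: group_hom_def group_hom_axioms_def cext_group)

lemma snd_mult: "x \<in> carrier cext \<Longrightarrow> y \<in> carrier cext
    \<Longrightarrow> snd (x \<otimes>\<^bsub>cext\<^esub> y) = snd x \<otimes> snd y"
  using snd_hom by (simp add: hom_def)

lemma snd_esec [simp]: "snd (esec g) = g"
  by (simp add: esec_def)

lemma snd_conj_act: "x \<in> carrier cext \<Longrightarrow> y \<in> carrier cext
    \<Longrightarrow> snd (conj_act cext x y) = conj_act G (snd x) (snd y)"
  by (simp add: conj_act_def snd_mult snd_inv)

lemma snd_commutator: "x \<in> carrier cext \<Longrightarrow> y \<in> carrier cext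
    \<Longrightarrow> snd (commutator_elt cext x y) = commutator_elt G (snd x) (snd y)"
  by (simp add: commutator_elt_def snd_mult snd_inv)

lemma ecomm_closed: "g \<in> carrier G \<Longrightarrow> h \<in> carrier G \<Longrightarrow> ecomm g h \<in> carrier cext"
  by (simp add: ecomm_def)

text \<open>By \<open>commutator_cext\<close> the lift of a product or of a conjugate may be
  replaced by the product or conjugate of lifts; then the commutator rules in \<open>cext\<close>
  apply.\<close>

lemma ecomm_mult_left:
  assumes "g \<in> carrier G" "g' \<in> carrier G" "h \<in> carrier G"
  shows "ecomm (g \<otimes> g') h = ecomm (conj_act G g g') (conj_act G g h) \<otimes>\<^bsub>cext\<^esub> ecomm g h"
proof -
  have "ecomm (g \<otimes> g') h = commutator_elt cext (esec g \<otimes>\<^bsub>cext\<^esub> esec g') (esec h)"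
    using assms commutator_cext[of "esec g \<otimes>\<^bsub>cext\<^esub> esec g'" "esec h"]
    by (simp add: ecomm_def snd_mult)
  also have "\<dots> = commutator_elt cext (conj_act cext (esec g) (esec g')) (conj_act cext (esec g) (esec h))
      \<otimes>\<^bsub>cext\<^esub> ecomm g h"
    using assms by (simp add: E.commutator_mult_left ecomm_def)
  finally show ?thesis
    using assms commutator_cext[of "conj_act cext (esec g) (esec g')" "conj_act cext (esec g) (esec h)"]
    by (simp add: ecomm_def snd_conj_act)
qed

lemma ecomm_mult_right:
  assumes "g \<in> carrier G" "h \<in> carrier G" "h' \<in> carrier G"
  shows "ecomm g (h \<otimes> h') = ecomm g h \<otimes>\<^bsub>cext\<^esub> ecomm (conj_act G h g) (conj_act G h h')"
proof -
  have "ecomm g (h \<otimes> h') = commutator_elt cext (esec g) (esec h \<otimes>\<^bsub>cext\<^esub> esec h')"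
    using assms commutator_cext[of "esec g" "esec h \<otimes>\<^bsub>cext\<^esub> esec h'"]
    by (simp add: ecomm_def snd_mult)
  also have "\<dots> = ecomm g h \<otimes>\<^bsub>cext\<^esub>
      commutator_elt cext (conj_act cext (esec h) (esec g)) (conj_act cext (esec h) (esec h'))"
    using assms by (simp add: E.commutator_mult_right ecomm_def)
  finally show ?thesis
    using assms commutator_cext[of "conj_act cext (esec h) (esec g)" "conj_act cext (esec h) (esec h')"]
    by (simp add: ecomm_def snd_conj_act)
qed

text \<open>A homomorphism out of the extension amounts to values on \<open>B\<close> and on the
  section; \<open>P\<close> demands that the multiplication defect of the section be
  respected.\<close>

lemma cext_hom:
  assumes "group H" "\<psi> \<in> hom B H" "\<And>g. g \<in> carrier G \<Longrightarrow> P g \<in> carrier H"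
    and central: "\<And>b g. b \<in> carrier B \<Longrightarrow> g \<in> carrier G \<Longrightarrow> \<psi> b \<otimes>\<^bsub>H\<^esub> P g = P g \<otimes>\<^bsub>H\<^esub> \<psi> b"
    and P: "\<And>g h. g \<in> carrier G \<Longrightarrow> h \<in> carrier G
      \<Longrightarrow> \<psi> (f g h) \<otimes>\<^bsub>H\<^esub> P (g \<otimes> h) = P g \<otimes>\<^bsub>H\<^esub> P h"
  shows "(\<lambda>(b, g). \<psi> b \<otimes>\<^bsub>H\<^esub> P g) \<in> hom cext H"
proof -
  interpret H: group H by fact
  have \<psi> [simp]: "\<psi> b \<in> carrier H" "\<psi> (b \<otimes>\<^bsub>B\<^esub> c) = \<psi> b \<otimes>\<^bsub>H\<^esub> \<psi> c"
    if "b \<in> carrier B" "c \<in> carrier B" for b c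
    using assms(2) that by (auto simp: hom_def)
  show ?thesis
  proof (rule homI)
    fix x assume "x \<in> carrier cext"
    then show "(\<lambda>(b, g). \<psi> b \<otimes>\<^bsub>H\<^esub> P g) x \<in> carrier H"
      using \<psi>(1) assms(3) by (cases x) auto
  next
    fix x y assume "x \<in> carrier cext" "y \<in> carrier cext"
    then obtain b g c h where x: "x = (b, g)" "b \<in> carrier B" "g \<in> carrier G"
      and y: "y = (c, h)" "c \<in> carrier B" "h \<in> carrier G"
      by (cases x; cases y) auto
    note [simp] = assms(3) \<psi>(1)[OF x(2) x(2)] \<psi>(1)[OF y(2) y(2)]
    have "\<psi> (b \<otimes>\<^bsub>B\<^esub> c \<otimes>\<^bsub>B\<^esub> f g h) \<otimes>\<^bsub>H\<^esub> P (g \<otimes> h) = \<psi> b \<otimes>\<^bsub>H\<^esub> \<psi> c \<otimes>\<^bsub>H\<^esub> (\<psi> (f g h) \<otimes>\<^bsub>H\<^esub> P (g \<otimes> h))"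
      using x y \<psi>(1)[of "f g h" b] by (simp add: H.m_assoc)
    also have "\<dots> = \<psi> b \<otimes>\<^bsub>H\<^esub> (\<psi> c \<otimes>\<^bsub>H\<^esub> P g) \<otimes>\<^bsub>H\<^esub> P h"
      using x y by (simp add: P H.m_assoc)
    also have "\<dots> = \<psi> b \<otimes>\<^bsub>H\<^esub> P g \<otimes>\<^bsub>H\<^esub> (\<psi> c \<otimes>\<^bsub>H\<^esub> P h)"
      using x y by (simp add: central[of c g] H.m_assoc)
    finally show "(\<lambda>(b, g). \<psi> b \<otimes>\<^bsub>H\<^esub> P g) (x \<otimes>\<^bsub>cext\<^esub> y)
        = (\<lambda>(b, g). \<psi> b \<otimes>\<^bsub>H\<^esub> P g) x \<otimes>\<^bsub>H\<^esub> (\<lambda>(b, g). \<psi> b \<otimes>\<^bsub>H\<^esub> P g) y"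
      using x y by simp
  qed
qed

end

section \<open>The bar complex\<close>

lemma (in group) commute_generate:
  assumes "c \<in> carrier G" "A \<subseteq> carrier G" "\<And>a. a \<in> A \<Longrightarrow> c \<otimes> a = a \<otimes> c" "u \<in> generate G A"
  shows "c \<otimes> u = u \<otimes> c"
  using assms(4)
proof induction
  case (inv a)
  then have a: "a \<in> carrier G" using assms(2) by blast
  have "inv a \<otimes> (c \<otimes> a) \<otimes> inv a = inv a \<otimes> (a \<otimes> c) \<otimes> inv a"
    using assms(3) inv by simp
  then show ?case using a assms(1) by (simp add: m_assoc)
next
  case (eng u v)
  then have "u \<in> carrier G" "v \<in> carrier G" using generate_in_carrier[OF assms(2)] by auto
  then show ?case using eng.IH assms(1) by (metis m_assoc)
qed (use assms in auto)

context tensor_group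
begin

section \<open>Two-chains modulo boundaries and their universal cocycle\<close>

abbreviation "C1 \<equiv> free_Abelian_group (carrier G)"
abbreviation "C2 \<equiv> free_Abelian_group (carrier G \<times> carrier G)"
abbreviation "C3 \<equiv> free_Abelian_group (carrier G \<times> carrier G \<times> carrier G)"

definition bar_boundaries :: "('a \<times> 'a \<Rightarrow>\<^sub>0 int) set" where
  "bar_boundaries = bar_d3 G ` carrier C3"

text \<open>All 2-chains are kept, not just cycles, so that the classes of the basis elements form a
  universal 2-cocycle; the homology group sits inside.\<close>

definition bar_quot :: "('a \<times> 'a \<Rightarrow>\<^sub>0 int) set monoid" where
  "bar_quot = C2 Mod bar_boundaries"

definition bar_class :: "'a \<Rightarrow> 'a \<Rightarrow> ('a \<times> 'a \<Rightarrow>\<^sub>0 int) set" where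
  "bar_class g h = bar_boundaries #>\<^bsub>C2\<^esub> frag_of (g, h)"

lemma frag_extend_hom:
  assumes "\<And>s. s \<in> S \<Longrightarrow> Poly_Mapping.keys (F s) \<subseteq> S'"
  shows "frag_extend F \<in> hom (free_Abelian_group S) (free_Abelian_group S')"
proof (rule homI)
  fix c assume "c \<in> carrier (free_Abelian_group S)"
  then show "frag_extend F c \<in> carrier (free_Abelian_group S')"
    using assms keys_frag_extend[of F c] by (fastforce simp: subset_iff)
qed (simp add: frag_extend_add)

lemma keys_add_le: "Poly_Mapping.keys a \<subseteq> S \<Longrightarrow> Poly_Mapping.keys b \<subseteq> S
    \<Longrightarrow> Poly_Mapping.keys (a + b) \<subseteq> S"
  using keys_add[of a b] by blast

lemma keys_diff_le: "Poly_Mapping.keys a \<subseteq> S \<Longrightarrow> Poly_Mapping.keys b \<subseteq> S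
    \<Longrightarrow> Poly_Mapping.keys (a - b) \<subseteq> S"
  using keys_diff[of a b] by blast

lemma bar_d2_hom: "bar_d2 G \<in> hom C2 C1"
  unfolding bar_d2_def
proof (rule frag_extend_hom)
  fix s assume "s \<in> carrier G \<times> carrier G"
  then show "Poly_Mapping.keys ((\<lambda>(g, h). frag_of h - frag_of (g \<otimes> h) + frag_of g) s) \<subseteq> carrier G"
    by (cases s) (simp add: keys_add_le keys_diff_le)
qed

lemma bar_d3_hom: "bar_d3 G \<in> hom C3 C2"
  unfolding bar_d3_def
proof (rule frag_extend_hom)
  fix s assume "s \<in> carrier G \<times> carrier G \<times> carrier G"
  then show "Poly_Mapping.keys ((\<lambda>(g, h, k). frag_of (h, k) - frag_of (g \<otimes> h, k)
      + frag_of (g, h \<otimes> k) - frag_of (g, h)) s) \<subseteq> carrier G \<times> carrier G"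
    by (cases s) (simp add: keys_add_le keys_diff_le)
qed

lemma C2_group_hom_d3: "group_hom C3 C2 (bar_d3 G)"
  using bar_d3_hom by (simp add: group_hom_def group_hom_axioms_def)

lemma bar_boundaries_subgroup: "subgroup bar_boundaries C2"
  unfolding bar_boundaries_def by (rule group_hom.img_is_subgroup[OF C2_group_hom_d3])

lemma bar_boundaries_normal: "bar_boundaries \<lhd> C2"
  by (rule comm_group.subgroup_imp_normal[OF abelian_free_Abelian_group bar_boundaries_subgroup])

lemma bar_quot_comm: "comm_group bar_quot"
  unfolding bar_quot_def
  by (rule comm_group.abelian_FactGroup[OF abelian_free_Abelian_group bar_boundaries_subgroup])

lemma bar_proj_hom: "(\<lambda>c. bar_boundaries #>\<^bsub>C2\<^esub> c) \<in> hom C2 bar_quot"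
  unfolding bar_quot_def by (rule normal.r_coset_hom_Mod[OF bar_boundaries_normal])

lemma bar_proj_eqI:
  assumes "x \<in> carrier C2" "y \<in> carrier C2" "y - x \<in> bar_boundaries"
  shows "bar_boundaries #>\<^bsub>C2\<^esub> x = bar_boundaries #>\<^bsub>C2\<^esub> y"
proof (rule group.repr_independence[OF group_free_Abelian_group _ assms(1) bar_boundaries_subgroup])
  have "y = (y - x) \<otimes>\<^bsub>C2\<^esub> x" by simp
  then show "y \<in> bar_boundaries #>\<^bsub>C2\<^esub> x"
    using assms(3) unfolding r_coset_def by blast
qed

text \<open>The two sides of the cocycle identity differ by the boundary of the basis element
  \<open>[g|h|k]\<close>.\<close>

lemma bar_cocycle: "cocycle_extension G bar_quot bar_class"
proof (intro cocycle_extension.intro cocycle_extension_axioms.intro)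
  show "comm_group bar_quot" by (rule bar_quot_comm)
  fix g h assume gh: "g \<in> carrier G" "h \<in> carrier G"
  then show "bar_class g h \<in> carrier bar_quot"
    unfolding bar_class_def using hom_in_carrier[OF bar_proj_hom] by simp
  fix k assume k: "k \<in> carrier G"
  let ?x = "frag_of (h, k) + frag_of (g, h \<otimes> k)" and ?y = "frag_of (g \<otimes> h, k) + frag_of (g, h)"
  have "?x - ?y = bar_d3 G (frag_of (g, h, k))"
    by (simp add: bar_d3_def)
  then have "?x - ?y \<in> bar_boundaries"
    unfolding bar_boundaries_def using gh k by auto
  then have "bar_boundaries #>\<^bsub>C2\<^esub> ?y = bar_boundaries #>\<^bsub>C2\<^esub> ?x"
    using gh k by (intro bar_proj_eqI) (simp_all add: keys_add_le)
  moreover have "bar_boundaries #>\<^bsub>C2\<^esub> (frag_of a + frag_of b)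
      = (bar_boundaries #>\<^bsub>C2\<^esub> frag_of a) \<otimes>\<^bsub>bar_quot\<^esub> (bar_boundaries #>\<^bsub>C2\<^esub> frag_of b)"
    if "a \<in> carrier G \<times> carrier G" "b \<in> carrier G \<times> carrier G" for a b
    using hom_mult[OF bar_proj_hom, of "frag_of a" "frag_of b"] that by simp
  ultimately show "bar_class h k \<otimes>\<^bsub>bar_quot\<^esub> bar_class g (h \<otimes> k)
      = bar_class (g \<otimes> h) k \<otimes>\<^bsub>bar_quot\<^esub> bar_class g h"
    using gh k by (simp add: bar_class_def)
qed (rule is_group)

end

sublocale tensor_group \<subseteq> bar: cocycle_extension G bar_quot bar_class
  by (rule bar_cocycle)

context tensor_group
begin

text \<open>A family \<open>z\<close> extends linearly to 2-chains, and the cocycle identity says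
  that the extension vanishes on the boundaries of basis 3-chains.\<close>

lemma bar_universal:
  assumes Z: "comm_group Z" and closed: "\<And>g h. g \<in> carrier G \<Longrightarrow> h \<in> carrier G \<Longrightarrow> z g h \<in> carrier Z"
    and cocycle: "\<And>g h k. g \<in> carrier G \<Longrightarrow> h \<in> carrier G \<Longrightarrow> k \<in> carrier G
      \<Longrightarrow> z h k \<otimes>\<^bsub>Z\<^esub> z g (h \<otimes> k) = z (g \<otimes> h) k \<otimes>\<^bsub>Z\<^esub> z g h"
  obtains \<psi> where "\<psi> \<in> hom bar_quot Z"
    "\<And>g h. g \<in> carrier G \<Longrightarrow> h \<in> carrier G \<Longrightarrow> \<psi> (bar_class g h) = z g h"
proof -
  interpret Z: comm_group Z by fact
  have "(\<lambda>(g, h). z g h) ` (carrier G \<times> carrier G) \<subseteq> carrier Z" using closed by auto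
  from Z.free_Abelian_group_universal[OF this] obtain \<phi> where \<phi>: "\<phi> \<in> hom C2 Z"
    "\<And>x. x \<in> carrier G \<times> carrier G \<Longrightarrow> \<phi> (frag_of x) = (\<lambda>(g, h). z g h) x"
    by metis
  interpret \<phi>: group_hom C2 Z \<phi>
    using \<phi>(1) by (simp add: group_hom_def group_hom_axioms_def Z.is_group)
  have "bar_boundaries \<subseteq> kernel C2 Z \<phi>"
  proof
    fix c assume "c \<in> bar_boundaries"
    then obtain d where d: "Poly_Mapping.keys d \<subseteq> carrier G \<times> carrier G \<times> carrier G" "c = bar_d3 G d"
      by (auto simp: bar_boundaries_def)
    have "(\<phi> \<circ> bar_d3 G) d = (\<lambda>_. \<one>\<^bsub>Z\<^esub>) d"
    proof (rule hom_free_Abelian_group_eq[OF Group.hom_compose[OF bar_d3_hom \<phi>(1)] _ Z.is_group _ d(1)])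
      show "(\<lambda>_. \<one>\<^bsub>Z\<^esub>) \<in> hom C3 Z" by (simp add: hom_def)
      fix s assume "s \<in> carrier G \<times> carrier G \<times> carrier G"
      then obtain g h k where s: "s = (g, h, k)" "g \<in> carrier G" "h \<in> carrier G" "k \<in> carrier G" by auto
      \<comment> \<open>The boundary of \<open>[g|h|k]\<close> is grouped as \<open>?x - ?y\<close>,
        matching the two sides of the cocycle identity.\<close>
      let ?x = "frag_of (h, k) + frag_of (g, h \<otimes> k)" and ?y = "frag_of (g \<otimes> h, k) + frag_of (g, h)"
      have c: "?x \<in> carrier C2" "?y \<in> carrier C2"
        using s by (simp_all add: keys_add_le)
      have \<phi>_add: "\<phi> (frag_of a + frag_of b) = \<phi> (frag_of a) \<otimes>\<^bsub>Z\<^esub> \<phi> (frag_of b)"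
        if "a \<in> carrier G \<times> carrier G" "b \<in> carrier G \<times> carrier G" for a b
        using \<phi>.hom_mult[of "frag_of a" "frag_of b"] that by simp
      have "?x - ?y \<in> carrier C2"
        using c by (simp add: keys_diff_le)
      then have "\<phi> (?x - ?y) \<otimes>\<^bsub>Z\<^esub> \<phi> ?y = \<phi> ?x"
        using \<phi>.hom_mult[of "?x - ?y" ?y] c by simp
      also have "\<phi> ?x = \<phi> ?y"
        using s cocycle[of g h k] by (simp add: \<phi>_add \<phi>(2))
      finally have "\<phi> (?x - ?y) = \<one>\<^bsub>Z\<^esub>"
        using c \<open>?x - ?y \<in> carrier C2\<close> \<phi>.hom_closed Z.r_cancel_one by metis
      moreover have "bar_d3 G (frag_of s) = ?x - ?y"
        by (simp add: bar_d3_def s)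
      ultimately show "(\<phi> \<circ> bar_d3 G) (frag_of s) = \<one>\<^bsub>Z\<^esub>" by simp
    qed
    then show "c \<in> kernel C2 Z \<phi>"
      using d hom_in_carrier[OF bar_d3_hom, of d] by (simp add: kernel_def)
  qed
  from \<phi>.FactGroup_universal_kernel[OF bar_boundaries_normal this] obtain \<psi> where
    "\<psi> \<in> hom (C2 Mod bar_boundaries) Z"
    "\<And>c. c \<in> carrier C2 \<Longrightarrow> \<psi> (bar_boundaries #>\<^bsub>C2\<^esub> c) = \<phi> c"
    by metis
  then show thesis
    by (intro that[of \<psi>]) (simp_all add: bar_quot_def bar_class_def \<phi>(2))
qed

text \<open>The defects of \<open>P\<close> form a 2-cocycle with central values, so
  \<open>bar_universal\<close> turns them into a map \<open>\<psi>\<close> on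
  \<open>bar_quot\<close>, and \<open>\<psi> b\<close> times \<open>P g\<close> is the required
  homomorphism. This is the universal property of \<open>F/[F,R]\<close> in terms of
  cocycles.\<close>

lemma cext_rep:
  assumes "group Q" and P: "\<And>g. g \<in> carrier G \<Longrightarrow> P g \<in> carrier Q"
    and comm: "\<And>g h x. g \<in> carrier G \<Longrightarrow> h \<in> carrier G \<Longrightarrow> x \<in> carrier G
      \<Longrightarrow> (P g \<otimes>\<^bsub>Q\<^esub> P h \<otimes>\<^bsub>Q\<^esub> inv\<^bsub>Q\<^esub> (P (g \<otimes> h))) \<otimes>\<^bsub>Q\<^esub> P x
        = P x \<otimes>\<^bsub>Q\<^esub> (P g \<otimes>\<^bsub>Q\<^esub> P h \<otimes>\<^bsub>Q\<^esub> inv\<^bsub>Q\<^esub> (P (g \<otimes> h)))"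
  obtains \<theta> where "\<theta> \<in> hom bar.cext Q" "\<And>g. g \<in> carrier G \<Longrightarrow> \<theta> (bar.esec g) = P g"
proof -
  interpret Q: group Q by fact
  define z where "z g h = P g \<otimes>\<^bsub>Q\<^esub> P h \<otimes>\<^bsub>Q\<^esub> inv\<^bsub>Q\<^esub> (P (g \<otimes> h))" for g h
  \<comment> \<open>The defects are known to commute with the values of \<open>P\<close>, so the
    centre \<open>Z\<close> is formed inside the subgroup \<open>U\<close> generated by these
    values.\<close>
  define U where "U = generate Q (P ` carrier G)"
  define Z where "Z = {c \<in> U. \<forall>u\<in>U. c \<otimes>\<^bsub>Q\<^esub> u = u \<otimes>\<^bsub>Q\<^esub> c}"
  have PQ: "P ` carrier G \<subseteq> carrier Q" using P by blast
  have U: "subgroup U Q" unfolding U_def by (rule Q.generate_is_subgroup[OF PQ])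
  have UQ: "u \<in> carrier Q" if "u \<in> U" for u using that U by (rule subgroup.mem_carrier[rotated])
  have PU: "P g \<in> U" if "g \<in> carrier G" for g
    unfolding U_def by (rule generate.incl) (use that in blast)
  have zU: "z g h \<in> U" if "g \<in> carrier G" "h \<in> carrier G" for g h
    unfolding z_def using that U PU by (simp add: subgroup.m_closed subgroup.m_inv_closed)
  have zZ: "z g h \<in> Z" if gh: "g \<in> carrier G" "h \<in> carrier G" for g h
  proof -
    have "z g h \<otimes>\<^bsub>Q\<^esub> u = u \<otimes>\<^bsub>Q\<^esub> z g h" if "u \<in> U" for u
      using that unfolding U_def
      by (rule Q.commute_generate[OF UQ[OF zU[OF gh]] PQ, rotated])
        (use gh comm in \<open>auto simp: z_def\<close>)
    then show ?thesis using zU gh by (simp add: Z_def)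
  qed
  have ZU: "a \<in> U" if "a \<in> Z" for a
    using that unfolding Z_def by blast
  have Z_comm: "a \<otimes>\<^bsub>Q\<^esub> u = u \<otimes>\<^bsub>Q\<^esub> a" if "a \<in> Z" "u \<in> U" for a u
    using that unfolding Z_def by blast
  have "subgroup Z Q"
  proof (rule Q.subgroupI)
    show "Z \<subseteq> carrier Q" using UQ by (auto simp: Z_def)
    have "\<one>\<^bsub>Q\<^esub> \<in> Z" using U UQ by (simp add: Z_def subgroup.one_closed)
    then show "Z \<noteq> {}" by blast
  next
    fix a assume a: "a \<in> Z"
    have "inv\<^bsub>Q\<^esub> a \<otimes>\<^bsub>Q\<^esub> u = u \<otimes>\<^bsub>Q\<^esub> inv\<^bsub>Q\<^esub> a" if u: "u \<in> U" for u
    proof -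
      have c: "a \<in> carrier Q" "u \<in> carrier Q" and au: "u \<otimes>\<^bsub>Q\<^esub> a = a \<otimes>\<^bsub>Q\<^esub> u"
        using a u UQ by (auto simp: Z_def)
      have "inv\<^bsub>Q\<^esub> a \<otimes>\<^bsub>Q\<^esub> u = inv\<^bsub>Q\<^esub> a \<otimes>\<^bsub>Q\<^esub> (u \<otimes>\<^bsub>Q\<^esub> a) \<otimes>\<^bsub>Q\<^esub> inv\<^bsub>Q\<^esub> a"
        using c by (simp add: Q.m_assoc)
      also have "\<dots> = u \<otimes>\<^bsub>Q\<^esub> inv\<^bsub>Q\<^esub> a"
        unfolding au using c by simp
      finally show ?thesis .
    qed
    then show "inv\<^bsub>Q\<^esub> a \<in> Z" using a U by (simp add: Z_def subgroup.m_inv_closed)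
  next
    fix a b assume ab: "a \<in> Z" "b \<in> Z"
    have "a \<otimes>\<^bsub>Q\<^esub> b \<otimes>\<^bsub>Q\<^esub> u = u \<otimes>\<^bsub>Q\<^esub> (a \<otimes>\<^bsub>Q\<^esub> b)" if u: "u \<in> U" for u
    proof -
      have c: "a \<in> carrier Q" "b \<in> carrier Q" "u \<in> carrier Q"
        and au: "a \<otimes>\<^bsub>Q\<^esub> u = u \<otimes>\<^bsub>Q\<^esub> a" and bu: "b \<otimes>\<^bsub>Q\<^esub> u = u \<otimes>\<^bsub>Q\<^esub> b"
        using ab u UQ by (auto simp: Z_def)
      have "a \<otimes>\<^bsub>Q\<^esub> b \<otimes>\<^bsub>Q\<^esub> u = (a \<otimes>\<^bsub>Q\<^esub> u) \<otimes>\<^bsub>Q\<^esub> b"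
        using c by (simp add: bu Q.m_assoc)
      also have "\<dots> = u \<otimes>\<^bsub>Q\<^esub> (a \<otimes>\<^bsub>Q\<^esub> b)"
        unfolding au using c by (simp add: Q.m_assoc)
      finally show ?thesis .
    qed
    moreover have "a \<otimes>\<^bsub>Q\<^esub> b \<in> U"
      using ab by (intro subgroup.m_closed[OF U]) (simp_all add: Z_def)
    ultimately show "a \<otimes>\<^bsub>Q\<^esub> b \<in> Z" unfolding Z_def by blast
  qed
  then have "group (Q\<lparr>carrier := Z\<rparr>)"
    by (rule Q.subgroup_imp_group)
  then have ZG: "comm_group (Q\<lparr>carrier := Z\<rparr>)"
    by (rule group.group_comm_groupI) (simp add: Z_comm[OF _ ZU])
  obtain \<psi> where \<psi>: "\<psi> \<in> hom bar_quot (Q\<lparr>carrier := Z\<rparr>)"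
    "\<And>g h. g \<in> carrier G \<Longrightarrow> h \<in> carrier G \<Longrightarrow> \<psi> (bar_class g h) = z g h"
  proof (rule bar_universal[OF ZG, of z])
    fix g h assume gh: "g \<in> carrier G" "h \<in> carrier G"
    then show "z g h \<in> carrier (Q\<lparr>carrier := Z\<rparr>)" using zZ by simp
    fix k assume k: "k \<in> carrier G"
    \<comment> \<open>Moving the central defect past \<open>P g\<close> shows that both sides of the
      cocycle identity equal the triple product of \<open>P g\<close>, \<open>P h\<close>,
      \<open>P k\<close> divided by the value of \<open>P\<close> at the full product.\<close>
    have "z h k \<otimes>\<^bsub>Q\<^esub> P g = P g \<otimes>\<^bsub>Q\<^esub> z h k"
      using gh k comm by (simp add: z_def)
    then have "z h k \<otimes>\<^bsub>Q\<^esub> z g (h \<otimes> k) = P g \<otimes>\<^bsub>Q\<^esub> z h k \<otimes>\<^bsub>Q\<^esub> P (h \<otimes> k) \<otimes>\<^bsub>Q\<^esub> inv\<^bsub>Q\<^esub> (P (g \<otimes> (h \<otimes> k)))"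
      using gh k P UQ zU unfolding z_def[of g "h \<otimes> k"] by (simp flip: Q.m_assoc)
    also have "\<dots> = P g \<otimes>\<^bsub>Q\<^esub> P h \<otimes>\<^bsub>Q\<^esub> P k \<otimes>\<^bsub>Q\<^esub> inv\<^bsub>Q\<^esub> (P (g \<otimes> (h \<otimes> k)))"
      using gh k P by (simp add: z_def Q.m_assoc)
    also have "\<dots> = z g h \<otimes>\<^bsub>Q\<^esub> z (g \<otimes> h) k"
      using gh k P by (simp add: z_def Q.m_assoc m_assoc)
    also have "\<dots> = z (g \<otimes> h) k \<otimes>\<^bsub>Q\<^esub> z g h"
      using gh k by (intro Z_comm zZ zU) simp_all
    finally show "z h k \<otimes>\<^bsub>Q\<lparr>carrier := Z\<rparr>\<^esub> z g (h \<otimes> k)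
        = z (g \<otimes> h) k \<otimes>\<^bsub>Q\<lparr>carrier := Z\<rparr>\<^esub> z g h" by simp
  qed metis
  have \<psi>Z: "\<psi> b \<in> Z" if "b \<in> carrier bar_quot" for b
    using hom_in_carrier[OF \<psi>(1) that] by simp
  have \<psi>Q: "\<psi> \<in> hom bar_quot Q"
    using hom_mult[OF \<psi>(1)] UQ[OF ZU[OF \<psi>Z]] by (intro homI) simp_all
  have "(\<lambda>(b, g). \<psi> b \<otimes>\<^bsub>Q\<^esub> P g) \<in> hom bar.cext Q"
  proof (rule bar.cext_hom[OF Q.is_group \<psi>Q P])
    fix b g assume "b \<in> carrier bar_quot" "g \<in> carrier G"
    then show "\<psi> b \<otimes>\<^bsub>Q\<^esub> P g = P g \<otimes>\<^bsub>Q\<^esub> \<psi> b" by (intro Z_comm \<psi>Z PU)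
  next
    fix g h assume "g \<in> carrier G" "h \<in> carrier G"
    then show "\<psi> (bar_class g h) \<otimes>\<^bsub>Q\<^esub> P (g \<otimes> h) = P g \<otimes>\<^bsub>Q\<^esub> P h"
      using P by (simp add: \<psi>(2) z_def Q.m_assoc)
  qed
  moreover have "\<psi> \<one>\<^bsub>bar_quot\<^esub> = \<one>\<^bsub>Q\<^esub>"
    by (rule hom_one[OF \<psi>Q bar.B.is_group Q.is_group])
  ultimately show thesis
    using P by (intro that) (auto simp: bar.esec_def)
qed

end

section \<open>Miller's theorem\<close>

context tensor_group
begin

section \<open>The map \<open>omega\<close> and its kernel\<close>

definition omega where "omega = tlift bar.cext bar.ecomm"

lemma omega_hom: "omega \<in> hom T bar.cext"
  and omega_tens: "x \<in> carrier G \<Longrightarrow> y \<in> carrier G \<Longrightarrow> omega (tens x y) = bar.ecomm x y"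
  unfolding omega_def
  by (rule tlift_hom tlift_tens;
      simp add: bar.cext_group bar.ecomm_closed bar.ecomm_mult_left bar.ecomm_mult_right)+

lemma snd_omega: "t \<in> carrier T \<Longrightarrow> snd (omega t) = kappa G t"
proof -
  assume t: "t \<in> carrier T"
  have "(snd \<circ> omega) t = kappa G t"
  proof (rule hom_eq_on_T[OF _ kappa_hom is_group _ t])
    show "snd \<circ> omega \<in> hom T G"
      by (rule Group.hom_compose[OF omega_hom bar.snd_hom])
  qed (simp add: omega_tens bar.ecomm_def bar.snd_commutator kappa_tens)
  then show ?thesis by simp
qed

lemma omega_nabla:
  assumes "n \<in> nabla G"
  shows "omega n = \<one>\<^bsub>bar.cext\<^esub>"
proof -
  interpret w: group_hom T bar.cext omega
    by unfold_locales (rule omega_hom)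
  have "nabla G \<subseteq> kernel T bar.cext omega"
    unfolding nabla_def
    by (rule tp.W.generate_subgroup_incl[OF _ w.subgroup_kernel])
      (auto simp: kernel_def omega_tens bar.ecomm_def commutator_elt_def bar.E.m_assoc)
  then show ?thesis using assms by (auto simp: kernel_def)
qed

text \<open>Followed by the permutation representation of \<open>bar.cext\<close>,
  \<open>omega\<close> becomes left translation by the class of \<open>t\<close> in the exterior
  square, and translations are faithful.\<close>

lemma omega_kernel:
  assumes t: "t \<in> carrier T" "omega t = \<one>\<^bsub>bar.cext\<^esub>"
  shows "t \<in> nabla G"
proof -
  obtain wact where wact: "alternating_pairing G (exterior_square G) wact wed"
    using ex_exterior_pairing by metis
  obtain le lt :: "'a \<Rightarrow> 'a \<Rightarrow> bool" where lin: "class.linorder le lt"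
    using ex_linorder by metis
  interpret op: ordered_pairing G "exterior_square G" wact wed le lt
    using wact lin by (rule ordered_pairing.intro)
  obtain \<theta> where \<theta>: "\<theta> \<in> hom bar.cext op.Perm"
    "\<And>g. g \<in> carrier G \<Longrightarrow> \<theta> (bar.esec g) = op.Pperm g"
    by (rule cext_rep[OF op.Perm_group op.Perm_closed(1) op.Pperm_defect_commute]) auto
  interpret \<theta>: group_hom bar.cext op.Perm \<theta>
    using \<theta>(1) by (simp add: group_hom_def group_hom_axioms_def bar.cext_group op.Perm_group)
  have q: "(\<lambda>t. nabla G #>\<^bsub>T\<^esub> t) \<in> hom T (exterior_square G)"
    unfolding exterior_square_def using nabla_normal by (rule normal.r_coset_hom_Mod)
  \<comment> \<open>Both homomorphisms send \<open>tens x y\<close> to the translation by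
    \<open>wed x y\<close>: under \<open>\<theta>\<close> the lifts become \<open>Pperm x\<close>
    and \<open>Pperm y\<close>, whose commutator it is.\<close>
  have "(\<theta> \<circ> omega) t = (op.Lperm \<circ> (\<lambda>t. nabla G #>\<^bsub>T\<^esub> t)) t"
  proof (rule hom_eq_on_T[OF Group.hom_compose[OF omega_hom \<theta>(1)]
        Group.hom_compose[OF q op.Lperm_hom] op.Perm_group _ t(1)])
    fix x y assume xy: "x \<in> carrier G" "y \<in> carrier G"
    have "\<theta> (bar.ecomm x y) = commutator_elt op.Perm (op.Pperm x) (op.Pperm y)"
      using xy by (simp add: bar.ecomm_def commutator_elt_def \<theta>(2))
    also have "\<dots> = op.Lperm (wed x y)"
      using xy by (rule op.commutator_Pperm)
    finally show "(\<theta> \<circ> omega) (tens x y) = (op.Lperm \<circ> (\<lambda>t. nabla G #>\<^bsub>T\<^esub> t)) (tens x y)"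
      using xy by (simp add: omega_tens wed_def)
  qed
  then have "op.Lperm (nabla G #>\<^bsub>T\<^esub> t) = \<one>\<^bsub>op.Perm\<^esub>"
    using t by simp
  moreover have "op.Lperm \<one>\<^bsub>exterior_square G\<^esub> = \<one>\<^bsub>op.Perm\<^esub>"
    by (rule hom_one[OF op.Lperm_hom op.W.is_group op.Perm_group])
  ultimately have "nabla G #>\<^bsub>T\<^esub> t = \<one>\<^bsub>exterior_square G\<^esub>"
    using inj_onD[OF op.Lperm_inj] hom_in_carrier[OF q t(1)] op.W.one_closed by metis
  then show ?thesis
    using tp.W.coset_join1[OF _ t(1) nabla_subgroup] by (simp add: exterior_square_def)
qed

section \<open>The range of \<open>omega\<close> and the cycles it contains\<close>

lemma commutator_in_range_omega:
  assumes "x \<in> carrier bar.cext" "y \<in> carrier bar.cext"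
  shows "commutator_elt bar.cext x y \<in> omega ` carrier T"
proof -
  have "snd x \<in> carrier G" "snd y \<in> carrier G"
    using assms hom_in_carrier[OF bar.snd_hom] by auto
  then have "commutator_elt bar.cext x y = omega (tens (snd x) (snd y))"
    using bar.commutator_cext[OF assms] by (simp add: omega_tens bar.ecomm_def)
  then show ?thesis
    using tens_closed[OF \<open>snd x \<in> carrier G\<close> \<open>snd y \<in> carrier G\<close>] by (rule image_eqI)
qed

text \<open>A conjugate of \<open>d\<close> by \<open>x\<close> is the commutator of
  \<open>x\<close> and \<open>d\<close> times \<open>d\<close>, and all commutators lie in the
  range.\<close>

lemma range_omega_normal: "omega ` carrier T \<lhd> bar.cext"
proof -
  interpret w: group_hom T bar.cext omega
    by unfold_locales (rule omega_hom)
  show ?thesis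
    unfolding bar.E.normal_inv_iff
  proof (intro conjI ballI)
    show S: "subgroup (omega ` carrier T) bar.cext" by (rule w.img_is_subgroup)
    fix x d assume x: "x \<in> carrier bar.cext" and d: "d \<in> omega ` carrier T"
    then have "d \<in> carrier bar.cext" by auto
    then have "x \<otimes>\<^bsub>bar.cext\<^esub> d \<otimes>\<^bsub>bar.cext\<^esub> inv\<^bsub>bar.cext\<^esub> x
        = commutator_elt bar.cext x d \<otimes>\<^bsub>bar.cext\<^esub> d"
      using x by (simp add: commutator_elt_def bar.E.m_assoc)
    also have "\<dots> \<in> omega ` carrier T"
      using x d \<open>d \<in> carrier bar.cext\<close> commutator_in_range_omega S
      by (intro subgroup.m_closed[OF S]) simp_all
    finally show "x \<otimes>\<^bsub>bar.cext\<^esub> d \<otimes>\<^bsub>bar.cext\<^esub> inv\<^bsub>bar.cext\<^esub> x \<in> omega ` carrier T" .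
  qed
qed

lemma cext_Mod_comm: "comm_group (bar.cext Mod (omega ` carrier T))"
proof (rule group.group_comm_groupI)
  interpret D: normal "omega ` carrier T" bar.cext by (rule range_omega_normal)
  show "group (bar.cext Mod (omega ` carrier T))" by (rule D.factorgroup_is_group)
  fix X Y assume "X \<in> carrier (bar.cext Mod (omega ` carrier T))"
    "Y \<in> carrier (bar.cext Mod (omega ` carrier T))"
  then obtain x y where x: "x \<in> carrier bar.cext" "X = omega ` carrier T #>\<^bsub>bar.cext\<^esub> x"
    and y: "y \<in> carrier bar.cext" "Y = omega ` carrier T #>\<^bsub>bar.cext\<^esub> y"
    by (auto simp: carrier_FactGroup)
  have "x \<otimes>\<^bsub>bar.cext\<^esub> y = commutator_elt bar.cext x y \<otimes>\<^bsub>bar.cext\<^esub> (y \<otimes>\<^bsub>bar.cext\<^esub> x)"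
    using x y by (simp add: commutator_elt_def bar.E.m_assoc del: bar.cext_simps)
  then have "x \<otimes>\<^bsub>bar.cext\<^esub> y \<in> omega ` carrier T #>\<^bsub>bar.cext\<^esub> (y \<otimes>\<^bsub>bar.cext\<^esub> x)"
    using bar.E.rcosI[OF commutator_in_range_omega[OF x(1) y(1)] D.subset, of "y \<otimes>\<^bsub>bar.cext\<^esub> x"] x y
    by (simp del: bar.cext_simps)
  then have "omega ` carrier T #>\<^bsub>bar.cext\<^esub> (y \<otimes>\<^bsub>bar.cext\<^esub> x)
      = omega ` carrier T #>\<^bsub>bar.cext\<^esub> (x \<otimes>\<^bsub>bar.cext\<^esub> y)"
    using x y by (intro bar.E.repr_independence[OF _ _ D.subgroup_axioms]) simp_all
  then show "X \<otimes>\<^bsub>bar.cext Mod (omega ` carrier T)\<^esub> Y = Y \<otimes>\<^bsub>bar.cext Mod (omega ` carrier T)\<^esub> X"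
    using x y by (simp add: D.rcos_sum)
qed

text \<open>\<open>bar_d2\<close> descends to \<open>bar_quot\<close> because its values on basis
  elements satisfy the cocycle identity. As \<open>\<delta> (bar_class g h)\<close> is
  \<open>[g] + [h] - [gh]\<close>, adding the basis element of the second component gives a
  homomorphism.\<close>

lemma ex_bar_boundary:
  obtains \<delta> where "\<delta> \<in> hom bar_quot C1"
    "\<And>c. c \<in> carrier C2 \<Longrightarrow> \<delta> (bar_boundaries #>\<^bsub>C2\<^esub> c) = bar_d2 G c"
    "(\<lambda>(b, g). \<delta> b + frag_of g) \<in> hom bar.cext C1"
proof -
  let ?z = "\<lambda>g h. frag_of h - frag_of (g \<otimes> h) + frag_of g"
  obtain \<delta> where \<delta>: "\<delta> \<in> hom bar_quot C1"
    "\<And>g h. g \<in> carrier G \<Longrightarrow> h \<in> carrier G \<Longrightarrow> \<delta> (bar_class g h) = ?z g h"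
    by (rule bar_universal[OF abelian_free_Abelian_group[of "carrier G"], of ?z],
        simp add: keys_add_le keys_diff_le, simp add: m_assoc algebra_simps, rule that)
  have "(\<delta> \<circ> (\<lambda>c. bar_boundaries #>\<^bsub>C2\<^esub> c)) c = bar_d2 G c" if "c \<in> carrier C2" for c
  proof (rule hom_free_Abelian_group_eq[OF Group.hom_compose[OF bar_proj_hom \<delta>(1)] bar_d2_hom])
    fix s assume "s \<in> carrier G \<times> carrier G"
    then show "(\<delta> \<circ> (\<lambda>c. bar_boundaries #>\<^bsub>C2\<^esub> c)) (frag_of s) = bar_d2 G (frag_of s)"
      using \<delta>(2) by (cases s) (simp add: bar_d2_def bar_class_def)
  qed (use that in simp_all)
  then have d2: "\<And>c. c \<in> carrier C2 \<Longrightarrow> \<delta> (bar_boundaries #>\<^bsub>C2\<^esub> c) = bar_d2 G c" by simp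
  have "(\<lambda>(b, g). \<delta> b \<otimes>\<^bsub>C1\<^esub> frag_of g) \<in> hom bar.cext C1"
    by (rule bar.cext_hom[OF _ \<delta>(1)]) (simp_all add: \<delta>(2) add.commute)
  then have "(\<lambda>(b, g). \<delta> b + frag_of g) \<in> hom bar.cext C1" by simp
  from that[OF \<delta>(1) d2 this] show thesis .
qed

lemma omega_kernel_boundary:
  assumes "p \<in> hom bar.cext C1" "t \<in> carrier T"
  shows "p (omega t) = 0"
proof -
  interpret p: group_hom bar.cext C1 p
    using assms(1) by (simp add: group_hom_def group_hom_axioms_def bar.cext_group)
  have "(p \<circ> omega) t = (\<lambda>_. \<one>\<^bsub>C1\<^esub>) t"
  proof (rule hom_eq_on_T[OF Group.hom_compose[OF omega_hom assms(1)] _ group_free_Abelian_group _ assms(2)])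
    show "(\<lambda>_. \<one>\<^bsub>C1\<^esub>) \<in> hom T C1" by (simp add: hom_def)
    fix x y assume xy: "x \<in> carrier G" "y \<in> carrier G"
    let ?a = "p (bar.esec x)" and ?b = "p (bar.esec y)"
    have c: "?a \<in> carrier C1" "?b \<in> carrier C1" using xy p.hom_closed bar.esec_closed by blast+
    have "p (bar.ecomm x y) = ?a \<otimes>\<^bsub>C1\<^esub> ?b \<otimes>\<^bsub>C1\<^esub> inv\<^bsub>C1\<^esub> ?a \<otimes>\<^bsub>C1\<^esub> inv\<^bsub>C1\<^esub> ?b"
      using xy by (simp add: bar.ecomm_def commutator_elt_def
          del: mult_free_Abelian_group inv_free_Abelian_group)
    also have "\<dots> = \<one>\<^bsub>C1\<^esub>"
      using c by simp
    finally show "(p \<circ> omega) (tens x y) = \<one>\<^bsub>C1\<^esub>"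
      using xy by (simp add: omega_tens)
  qed
  then show ?thesis by simp
qed

text \<open>The quotient of \<open>bar.cext\<close> by the range is commutative, so
  \<open>[g] \<mapsto>\<close> class of \<open>bar.esec g\<close> extends to a homomorphism
  \<open>s\<close> on \<open>C1\<close>. In the quotient the inclusion of a chain equals
  \<open>s\<close> of its boundary, which is trivial for a cycle.\<close>

lemma bar_cycle_in_range_omega:
  assumes "c \<in> carrier C2" "bar_d2 G c = 0"
  shows "bar.einc (bar_boundaries #>\<^bsub>C2\<^esub> c) \<in> omega ` carrier T"
proof -
  let ?D = "omega ` carrier T" and ?Q = "bar.cext Mod (omega ` carrier T)"
  let ?q = "\<lambda>x. omega ` carrier T #>\<^bsub>bar.cext\<^esub> x"
  interpret Q: comm_group ?Q by (rule cext_Mod_comm)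
  interpret D: normal ?D bar.cext by (rule range_omega_normal)
  interpret q: group_hom bar.cext ?Q ?q
    by unfold_locales (rule D.r_coset_hom_Mod)
  have "(\<lambda>g. ?q (bar.esec g)) ` carrier G \<subseteq> carrier ?Q"
    using q.hom_closed by auto
  from Q.free_Abelian_group_universal[OF this] obtain s where s: "s \<in> hom C1 ?Q"
    "\<And>g. g \<in> carrier G \<Longrightarrow> s (frag_of g) = ?q (bar.esec g)"
    by metis
  have iq: "?q \<circ> (bar.einc \<circ> (\<lambda>c. bar_boundaries #>\<^bsub>C2\<^esub> c)) \<in> hom C2 ?Q"
    by (intro Group.hom_compose[OF _ D.r_coset_hom_Mod] Group.hom_compose[OF bar_proj_hom]
        bar.einc_hom)
  have "(?q \<circ> (bar.einc \<circ> (\<lambda>c. bar_boundaries #>\<^bsub>C2\<^esub> c))) c = (s \<circ> bar_d2 G) c"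
  proof (rule hom_free_Abelian_group_eq[OF iq Group.hom_compose[OF bar_d2_hom s(1)] Q.is_group])
    fix x assume "x \<in> carrier G \<times> carrier G"
    then obtain g h where x: "x = (g, h)" "g \<in> carrier G" "h \<in> carrier G" by auto
    interpret s: group_hom C1 ?Q s
      using s(1) by (simp add: group_hom_def group_hom_axioms_def Q.is_group)
    have d: "bar_d2 G (frag_of x) \<in> carrier C1"
      by (rule hom_in_carrier[OF bar_d2_hom]) (use x in simp)
    \<comment> \<open>The rule \<open>bar.esec_mult\<close> is read in the quotient and compared
      with the relation between \<open>[g]\<close>, \<open>[h]\<close> and \<open>[gh]\<close> given
      by \<open>bar_d2\<close>.\<close>
    have "?q (bar.einc (bar_class g h)) \<otimes>\<^bsub>?Q\<^esub> ?q (bar.esec (g \<otimes> h))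
        = ?q (bar.esec g) \<otimes>\<^bsub>?Q\<^esub> ?q (bar.esec h)"
      using x bar.esec_mult[of g h]
      by (simp del: mult_FactGroup bar.cext_simps flip: q.hom_mult)
    also have "\<dots> = s (frag_of g + frag_of h)"
      using x s.hom_mult[of "frag_of g" "frag_of h"] by (simp add: s(2))
    also have "frag_of g + frag_of h = bar_d2 G (frag_of x) + frag_of (g \<otimes> h)"
      by (simp add: x(1) bar_d2_def)
    also have "s \<dots> = s (bar_d2 G (frag_of x)) \<otimes>\<^bsub>?Q\<^esub> ?q (bar.esec (g \<otimes> h))"
      using x d s.hom_mult[of "bar_d2 G (frag_of x)" "frag_of (g \<otimes> h)"] by (simp add: s(2))
    finally have "?q (bar.einc (bar_class g h)) = s (bar_d2 G (frag_of x))"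
      using x d by (subst (asm) Q.right_cancel) auto
    then show "(?q \<circ> (bar.einc \<circ> (\<lambda>c. bar_boundaries #>\<^bsub>C2\<^esub> c))) (frag_of x)
        = (s \<circ> bar_d2 G) (frag_of x)"
      by (simp add: x(1) bar_class_def)
  qed (use assms in simp)
  then have "?q (bar.einc (bar_boundaries #>\<^bsub>C2\<^esub> c)) = s 0"
    using assms(2) by simp
  also have "s 0 = ?D"
    using hom_one[OF s(1) _ Q.is_group] by simp
  finally show ?thesis
    using bar.E.coset_join1[OF _ _ D.subgroup_axioms] bar.einc_closed
      hom_in_carrier[OF bar_proj_hom assms(1)] by blast
qed

text \<open>Cosets and their products do not refer to the carrier of the ambient group, so
  \<open>H2 G\<close> literally consists of the cycle classes in \<open>bar_quot\<close>.\<close>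

lemma H2_simps:
  "carrier (H2 G) = (\<lambda>c. bar_boundaries #>\<^bsub>C2\<^esub> c) ` {c \<in> carrier C2. bar_d2 G c = 0}"
  "\<one>\<^bsub>H2 G\<^esub> = \<one>\<^bsub>bar_quot\<^esub>"
  "X \<otimes>\<^bsub>H2 G\<^esub> Y = X \<otimes>\<^bsub>bar_quot\<^esub> Y"
  by (simp_all add: H2_def Let_def carrier_FactGroup bar_quot_def bar_boundaries_def kernel_def)

lemma H2_group: "group (H2 G)"
proof -
  let ?K = "kernel C2 C1 (bar_d2 G)"
  interpret C2: comm_group C2 by (rule abelian_free_Abelian_group)
  interpret d: group_hom C2 C1 "bar_d2 G"
    using bar_d2_hom by (simp add: group_hom_def group_hom_axioms_def)
  obtain \<delta> where \<delta>: "\<delta> \<in> hom bar_quot C1"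
    "\<And>c. c \<in> carrier C2 \<Longrightarrow> \<delta> (bar_boundaries #>\<^bsub>C2\<^esub> c) = bar_d2 G c"
    by (rule ex_bar_boundary, rule that)
  have "bar_boundaries \<subseteq> ?K"
  proof
    fix c assume c: "c \<in> bar_boundaries"
    then have cC: "c \<in> carrier C2" by (rule subgroup.mem_carrier[OF bar_boundaries_subgroup])
    \<comment> \<open>That boundaries are cycles is read off \<open>\<delta>\<close>: the class of a
      boundary is trivial, and \<open>\<delta>\<close> of the class is
      \<open>bar_d2 G c\<close>.\<close>
    have "bar_boundaries #>\<^bsub>C2\<^esub> c = \<one>\<^bsub>bar_quot\<^esub>"
      using C2.coset_join2[OF cC bar_boundaries_subgroup c] by (simp add: bar_quot_def)
    then have "bar_d2 G c = 0"
      using \<delta>(2)[OF cC] hom_one[OF \<delta>(1) bar.B.is_group] by simp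
    then show "c \<in> ?K" using cC by (simp add: kernel_def)
  qed
  then have "bar_boundaries \<lhd> C2\<lparr>carrier := ?K\<rparr>"
    by (rule C2.normal_restrict_supergroup[OF d.subgroup_kernel bar_boundaries_normal])
  then have "group (C2\<lparr>carrier := ?K\<rparr> Mod bar_boundaries)"
    by (rule normal.factorgroup_is_group)
  then show ?thesis
    by (simp add: H2_def Let_def bar_boundaries_def)
qed

text \<open>On \<open>J\<close> the second component of \<open>omega\<close> is trivial, so
  \<open>omega\<close> lands in the central copy of \<open>bar_quot\<close>. Its range there is the
  group of cycle classes and its kernel is \<open>nabla G\<close>; the first isomorphism theorem
  concludes.\<close>

theorem Miller: "J_group G Mod nabla G \<cong> H2 G"
proof -
  let ?f = "bar_class \<one> \<one>"
  \<comment> \<open>The factor \<open>?f\<close> undoes the shift in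
    \<open>bar.einc\<close>.\<close>
  let ?\<Phi> = "\<lambda>t. fst (omega t) \<otimes>\<^bsub>bar_quot\<^esub> ?f"
  have JG: "group (J_group G)"
    unfolding J_group_def by (rule tp.W.subgroup_imp_group[OF kap.subgroup_kernel])
  have fst_omega: "fst (omega t) \<in> carrier bar_quot" if "t \<in> J" for t
    using hom_in_carrier[OF omega_hom, of t] that bar.cext_simps(1)[of "fst (omega t)" "snd (omega t)"]
    by (simp add: kernel_def)
  have omega_J: "omega t = (fst (omega t), \<one>)" if "t \<in> J" for t
    using that snd_omega by (intro prod_eqI) (simp_all add: kernel_def)
  have om: "omega t = bar.einc (?\<Phi> t)" "?\<Phi> t \<in> carrier bar_quot" if t: "t \<in> J" for t
    using fst_omega[OF t] omega_J[OF t] by (simp_all add: bar.einc_def bar.B.m_assoc)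
  obtain \<delta> where \<delta>: "\<delta> \<in> hom bar_quot C1"
    "\<And>c. c \<in> carrier C2 \<Longrightarrow> \<delta> (bar_boundaries #>\<^bsub>C2\<^esub> c) = bar_d2 G c"
    and p: "(\<lambda>(b, g). \<delta> b + frag_of g) \<in> hom bar.cext C1"
    by (rule ex_bar_boundary, rule that)
  have \<Phi>H: "?\<Phi> t \<in> carrier (H2 G)" if t: "t \<in> J" for t
  proof -
    obtain c where c: "c \<in> carrier C2" "?\<Phi> t = bar_boundaries #>\<^bsub>C2\<^esub> c"
      using om(2)[OF t] by (auto simp: bar_quot_def carrier_FactGroup)
    have "(\<lambda>(b, g). \<delta> b + frag_of g) (omega t) = 0"
      using omega_kernel_boundary[OF p, of t] t by (simp add: kernel_def)
    then have "\<delta> (fst (omega t)) + frag_of \<one> = 0"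
      by (subst (asm) omega_J[OF t]) simp
    \<comment> \<open>The same factor \<open>?f\<close> contributes exactly the basis element of
      \<open>\<one>\<close> that stems from the second component of \<open>omega t\<close>.\<close>
    moreover have "\<delta> ?f = frag_of \<one>"
      using \<delta>(2)[of "frag_of (\<one>, \<one>)"] by (simp add: bar_class_def bar_d2_def)
    ultimately have "\<delta> (?\<Phi> t) = 0"
      using hom_mult[OF \<delta>(1) fst_omega[OF t], of ?f] by simp
    then show ?thesis
      using c \<delta>(2)[OF c(1)] by (auto simp: H2_simps)
  qed
  have \<Phi>_mult: "?\<Phi> (s \<otimes>\<^bsub>T\<^esub> t) = ?\<Phi> s \<otimes>\<^bsub>bar_quot\<^esub> ?\<Phi> t" if st: "s \<in> J" "t \<in> J" for s t
  proof -
    have c: "s \<in> carrier T" "t \<in> carrier T" using st J_T by auto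
    have "omega (s \<otimes>\<^bsub>T\<^esub> t) = (fst (omega s), \<one>) \<otimes>\<^bsub>bar.cext\<^esub> (fst (omega t), \<one>)"
      using hom_mult[OF omega_hom c] st by (simp flip: omega_J)
    then show ?thesis
      using fst_omega[OF st(1)] fst_omega[OF st(2)] by (simp add: bar.B.m_ac)
  qed
  have \<Phi>: "?\<Phi> \<in> hom (J_group G) (H2 G)"
    by (rule homI) (simp_all add: J_group_def \<Phi>H \<Phi>_mult H2_simps(3))
  interpret \<Phi>: group_hom "J_group G" "H2 G" ?\<Phi>
    using JG H2_group \<Phi> by (simp add: group_hom_def group_hom_axioms_def)
  have "?\<Phi> ` carrier (J_group G) = carrier (H2 G)"
  proof
    show "?\<Phi> ` carrier (J_group G) \<subseteq> carrier (H2 G)"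
      using \<Phi>H by (auto simp: J_group_def)
    show "carrier (H2 G) \<subseteq> ?\<Phi> ` carrier (J_group G)"
    proof
      fix X assume "X \<in> carrier (H2 G)"
      then obtain c where c: "c \<in> carrier C2" "bar_d2 G c = 0" "X = bar_boundaries #>\<^bsub>C2\<^esub> c"
        by (auto simp: H2_simps)
      then obtain t where t: "t \<in> carrier T" "bar.einc X = omega t"
        using bar_cycle_in_range_omega by blast
      have X: "X \<in> carrier bar_quot" using c hom_in_carrier[OF bar_proj_hom] by simp
      \<comment> \<open>A preimage under \<open>omega\<close> of an element over
        \<open>\<one>\<close> lies in \<open>J\<close>, since \<open>omega\<close> covers
        \<open>kappa\<close>.\<close>
      have "kappa G t = \<one>"
        using snd_omega[OF t(1)] by (simp flip: t(2)) (simp add: bar.einc_def)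
      then have "t \<in> J" using t by (simp add: kernel_def)
      moreover have "?\<Phi> t = X"
        using X by (simp flip: t(2)) (simp add: bar.einc_def bar.B.m_assoc)
      ultimately show "X \<in> ?\<Phi> ` carrier (J_group G)"
        by (auto simp: J_group_def)
    qed
  qed
  moreover have "kernel (J_group G) (H2 G) ?\<Phi> = nabla G"
  proof
    show "kernel (J_group G) (H2 G) ?\<Phi> \<subseteq> nabla G"
    proof
      fix t assume "t \<in> kernel (J_group G) (H2 G) ?\<Phi>"
      then have t: "t \<in> J" "?\<Phi> t = \<one>\<^bsub>bar_quot\<^esub>"
        by (auto simp: kernel_def J_group_def H2_simps)
      then have "omega t = \<one>\<^bsub>bar.cext\<^esub>"
        using om(1)[OF t(1)] hom_one[OF bar.einc_hom bar.B.is_group bar.cext_group] by simp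
      then show "t \<in> nabla G"
        using t(1) J_T omega_kernel by blast
    qed
    show "nabla G \<subseteq> kernel (J_group G) (H2 G) ?\<Phi>"
    proof
      fix n assume n: "n \<in> nabla G"
      then have "?\<Phi> n = \<one>\<^bsub>bar_quot\<^esub>"
        by (simp add: omega_nabla bar.cext_one)
      then show "n \<in> kernel (J_group G) (H2 G) ?\<Phi>"
        using n nabla_J by (auto simp: kernel_def J_group_def H2_simps)
    qed
  qed
  ultimately show ?thesis
    using \<Phi>.FactGroup_iso by simp
qed

end

text \<open>The Brown-Loday identifications of the two homotopy groups stand as premises of the
  implications; the isomorphisms with \<open>H2 G\<close> and with the product are composed with
  them. The identification of \<open>H2 G\<close> is supplied by \<open>Miller\<close>, and
  \<open>Delta_eq_nabla\<close> passes between the two quotients of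
  \<open>J_group G\<close>.\<close>

theorem theorem4p9:
  fixes G :: "('a, 'm) monoid_scheme" and X :: "'b topology" and x0 :: 'b
  assumes "group G"
    and "\<forall>x\<in>carrier G. \<exists>n::nat. n > 0 \<and> x [^]\<^bsub>G\<^esub> n = \<one>\<^bsub>G\<^esub>"
    and "\<not> (\<exists>x\<in>carrier G. group.ord G x = 2)"
  shows "tensor_square G \<cong> nabla_group G \<times>\<times> exterior_square G
    \<and> J_group G Mod Delta G \<cong> H2 G
    \<and> J_group G \<cong> H2 G \<times>\<times> nabla_group G
    \<and> (eilenberg_maclane_1 G X x0 \<longrightarrow>
         (pi_2_stable X \<cong> J_group G Mod Delta G \<longrightarrow> pi_2_stable X \<cong> H2 G) \<and>
         (pi_3_S X \<cong> J_group G \<longrightarrow> pi_3_S X \<cong> H2 G \<times>\<times> nabla_group G))"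
proof -
  interpret odd_torsion_group G
    using assms by (simp add: odd_torsion_group_def odd_torsion_group_axioms_def tensor_group_def)
  have JD: "J_group G Mod Delta G \<cong> H2 G"
    using Miller by (simp add: Delta_eq_nabla)
  have "group (nabla_group G)"
    unfolding nabla_group_def by (rule tp.W.subgroup_imp_group[OF nabla_subgroup])
  then have "nabla_group G \<times>\<times> (J_group G Mod nabla G) \<cong> nabla_group G \<times>\<times> H2 G"
    using Miller by (intro group.DirProd_iso_trans iso_refl)
  then have J: "J_group G \<cong> H2 G \<times>\<times> nabla_group G"
    using J_group_split iso_trans DirProd_commute_iso by metis
  show ?thesis
    by (intro conjI impI tensor_square_split JD J iso_trans[OF _ JD] iso_trans[OF _ J])
qed

end
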